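(* For every $\alpha\in K^{(2)}$ there exists an integer $m_\alpha$ such that $q^{-m}\in\mathrm{Sp}(\alpha)$ for every integer $m\ge m_\alpha$. Moreover, if $s$ denotes the length of the (shortest) periodic part $b_1,\dots,b_s$ of the continued fraction expansion of $\alpha$ and $d=\max\{\deg b_1,\dots,\deg b_s\}$, then $m_\alpha=2d(s+1)$ is an admissible value.
   Context: $q$ is a positive power of a prime, $R=\mathbb F_q[Y]$, $K=\mathbb F_q(Y)$, $\widehat K=\mathbb F_q((Y^{-1}))$ with absolute value $|P/Q|=q^{\deg P-\deg Q}$ extended to $\widehat K$; $K^{(2)}=\{f\in\widehat K:[K(f):K]=2\}$. Each $\alpha\in K^{(2)}$ has an eventually periodic continued fraction expansion $[a_0;a_1,\dots,a_r,\overline{b_1,\dots,b_s}]$ (with $a_i,b_i$ nonconstant polynomials for $i\ge1$, $s$ minimal). $\alpha^\sigma$ denotes the Galois conjugate, $\Theta_\alpha=\mathrm{PGL}_2(R)\cdot\{\alpha,\alpha^\sigma\}$ (homographic action on $\widehat K\cup\{\infty\}$), $c_\alpha(f)=\liminf_{\beta\in\Theta_\alpha,\ |\beta-\beta^\sigma|\to0}\frac{|f-\beta|}{|\beta-\beta^\sigma|}$ for $f\in\widehat K\setminus(K\cup\Theta_\alpha)$, and $\mathrm{Sp}(\alpha)=\{c_\alpha(f):f\in\widehat K\setminus(K\cup\Theta_\alpha)\}$. *)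

theory Defs
  imports "HOL-Computational_Algebra.Formal_Laurent_Series" "HOL-Library.Extended_Real" "HOL-Library.Cardinality"
begin

text \<open>
  Conventions. The finite field F_q is a type 'a of class finite and field, q = CARD('a).
  The completion F_q((Y^-1)) is modelled by the formal Laurent series 'a fls in the
  variable X = Y^-1; so the coefficient of Y^n is the coefficient with index -n.
\<close>

text \<open>R = F_q[Y]: Laurent series with no positive powers of X = Y^-1.\<close>
definition Rpoly :: "'a::field fls set" where
  "Rpoly = {f. \<forall>n>0. fls_nth f n = 0}"

definition Kfrac :: "'a::field fls set" where
  "Kfrac = {P / Q | P Q. P \<in> Rpoly \<and> Q \<in> Rpoly \<and> Q \<noteq> 0}"

text \<open>Absolute value |f| = q^(deg_Y f) = q^(- X-adic valuation).\<close>
definition absv :: "'a::{finite,field} fls \<Rightarrow> real" where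
  "absv f = (if f = 0 then 0 else real CARD('a) powr (- real_of_int (fls_subdegree f)))"

definition K2 :: "'a::field fls set" where
  "K2 = {f. f \<notin> Kfrac \<and> (\<exists>a\<in>Kfrac. \<exists>b\<in>Kfrac. \<exists>c\<in>Kfrac. a \<noteq> 0 \<and> a * f^2 + b * f + c = 0)}"

text \<open>Galois conjugate: the other root of the minimal polynomial a X^2 + b X + c over K.\<close>
definition qconj :: "'a::field fls \<Rightarrow> 'a fls" where
  "qconj f = (let (a, b, c) = (SOME (a, b, c). a \<in> Kfrac \<and> b \<in> Kfrac \<and> c \<in> Kfrac \<and> a \<noteq> 0
                 \<and> a * f^2 + b * f + c = 0) in - b / a - f)"

text \<open>Orbit Theta_alpha = PGL_2(R) . {alpha, alpha^sigma} under homographies.\<close>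
definition Theta :: "'a::field fls \<Rightarrow> 'a fls set" where
  "Theta \<alpha> = {(a * \<beta> + b) / (c * \<beta> + d) | a b c d \<beta>.
      a \<in> Rpoly \<and> b \<in> Rpoly \<and> c \<in> Rpoly \<and> d \<in> Rpoly \<and>
      (\<exists>u\<in>Rpoly. (a * d - b * c) * u = 1) \<and> \<beta> \<in> {\<alpha>, qconj \<alpha>}}"

text \<open>c_alpha(f) = liminf over beta in Theta_alpha with |beta - beta^sigma| -> 0.\<close>
definition capprox :: "'a::{finite,field} fls \<Rightarrow> 'a fls \<Rightarrow> ereal" where
  "capprox \<alpha> f = Liminf (inf (principal (Theta \<alpha>)) (filtercomap (\<lambda>\<beta>. absv (\<beta> - qconj \<beta>)) (nhds 0)))
      (\<lambda>\<beta>. ereal (absv (f - \<beta>) / absv (\<beta> - qconj \<beta>)))"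

definition Sp :: "'a::{finite,field} fls \<Rightarrow> ereal set" where
  "Sp \<alpha> = {capprox \<alpha> f | f. f \<notin> Kfrac \<and> f \<notin> Theta \<alpha>}"

definition polypart :: "'a::field fls \<Rightarrow> 'a fls" where
  "polypart f = Abs_fls (\<lambda>n. if n \<le> 0 then fls_nth f n else 0)"

primrec cf_rem :: "'a::field fls \<Rightarrow> nat \<Rightarrow> 'a fls" where
  "cf_rem f 0 = f"
| "cf_rem f (Suc n) = inverse (cf_rem f n - polypart (cf_rem f n))"

definition cf_quot :: "'a::field fls \<Rightarrow> nat \<Rightarrow> 'a fls" where
  "cf_quot f n = polypart (cf_rem f n)"

definition degY :: "'a::field fls \<Rightarrow> nat" where
  "degY f = nat (- fls_subdegree f)"

definition cf_period :: "'a::field fls \<Rightarrow> nat" where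
  "cf_period f = (LEAST s. s > 0 \<and> (\<exists>r. \<forall>n\<ge>r. cf_quot f (n + s) = cf_quot f n))"

definition cf_preperiod :: "'a::field fls \<Rightarrow> nat" where
  "cf_preperiod f = (LEAST r. r > 0 \<and> (\<forall>n\<ge>r. cf_quot f (n + cf_period f) = cf_quot f n))"

definition cf_maxdeg :: "'a::field fls \<Rightarrow> nat" where
  "cf_maxdeg f = Max {degY (cf_quot f n) | n. cf_preperiod f \<le> n \<and> n < cf_preperiod f + cf_period f}"

end

theory Submission
  imports Defs
begin

text \<open>
  For an irrational \<open>f\<close> and \<open>\<beta> \<in> \<Theta>\<^sub>\<alpha>\<close> with \<open>V = |f - \<beta>| < U = |\<beta> - \<beta>\<^sup>\<sigma>|\<close>, the interval of radii \<open>[V, U]\<close> records the part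
  of the path from infinity to \<open>f\<close> (in the Bruhat-Tits tree) that lies on the axis joining \<open>\<beta>\<close> to its conjugate.
  Two distinct axes of the orbit share at most \<open>2 log |\<delta>|\<close>, where \<open>\<delta>\<^sup>2\<close> is their common
  discriminant: the resultant-like quantity \<open>A B (\<beta> - \<gamma>) (\<beta>\<^sup>\<sigma> - \<gamma>\<^sup>\<sigma>)\<close> is a nonzero polynomial. The
  period of the continued fraction gives \<open>|\<delta>| \<le> q\<^bsup>ds\<^esup>\<close>, and no axis climbs higher than \<open>d\<close> in a horoball.

  To realise \<open>q\<^bsup>-m\<^esup>\<close>, take for \<open>f\<close> the purely periodic expansion of period \<open>A, w\<close>, where \<open>deg A > d\<close> and
  the word \<open>w\<close> follows the period of \<open>\<alpha>\<close> (up to its last letter) so that each copy of \<open>w\<close> shares a piece of length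
  exactly \<open>m\<close> with some axis. An axis cannot cross the horoballs of \<open>A\<close>; by rigidity any other axis
  shares at most \<open>2ds\<close> with that piece and at most \<open>2d\<close> with the rest of the copy, hence at most
  \<open>2d(s + 1) \<le> m\<close>.
\<close>

section \<open>The absolute value\<close>

lemma card_gt_one: "1 < real CARD('a::{finite,field})"
proof -
  have "card {0, 1::'a} \<le> CARD('a)" by (intro card_mono) auto
  thus ?thesis by simp
qed

lemma card_powr_le_iff [simp]:
  "real CARD('a::{finite,field}) powr a \<le> real CARD('a) powr b \<longleftrightarrow> a \<le> b"
  using card_gt_one[where 'a='a] by simp

lemma card_powr_less_iff [simp]:
  "real CARD('a::{finite,field}) powr a < real CARD('a) powr b \<longleftrightarrow> a < b"
  using card_gt_one[where 'a='a] by simp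

lemma absv_nz: "f \<noteq> 0 \<Longrightarrow> absv (f::'a::{finite,field} fls) = real CARD('a) powr (- real_of_int (fls_subdegree f))"
  by (simp add: absv_def)

lemma absv_0 [simp]: "absv 0 = 0"
  by (simp add: absv_def)

lemma absv_1 [simp]: "absv 1 = 1"
  using card_gt_one[where 'a='a] by (simp add: absv_def)

lemma absv_nonneg [simp]: "0 \<le> absv f"
  by (simp add: absv_def)

lemma absv_eq_0 [simp]: "absv f = 0 \<longleftrightarrow> f = 0"
  using card_gt_one[where 'a='a] by (simp add: absv_def)

lemma absv_pos_iff [simp]: "0 < absv f \<longleftrightarrow> f \<noteq> 0"
  by (metis absv_eq_0 absv_nonneg less_eq_real_def less_irrefl)

lemma absv_mult: "absv (f * g) = absv f * absv g"
  by (auto simp: absv_def powr_add[symmetric])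

lemma absv_inverse: "absv (inverse f) = inverse (absv f)"
proof (cases "f = 0")
  case False
  have "absv f * absv (inverse f) = 1"
    using False by (simp flip: absv_mult)
  thus ?thesis by (metis inverse_unique)
qed simp

lemma absv_divide: "absv (f / g) = absv f / absv g"
  by (simp add: divide_inverse absv_mult absv_inverse)

lemma absv_power: "absv (f ^ n) = absv f ^ n"
  by (induction n) (simp_all add: absv_mult)

lemma absv_uminus [simp]: "absv (- f) = absv f"
  by (simp add: absv_def)

lemma absv_minus_commute: "absv (f - g) = absv (g - f)"
  by (metis absv_uminus minus_diff_eq)

lemma absv_add_le: "absv (f + g) \<le> max (absv f) (absv g)"
proof (cases "f = 0 \<or> g = 0 \<or> f + g = 0")
  case True
  thus ?thesis by (auto simp: max_def)
next
  case False
  hence "min (fls_subdegree f) (fls_subdegree g) \<le> fls_subdegree (f + g)"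
    by (intro fls_plus_subdegree) auto
  thus ?thesis using False by (auto simp: absv_nz max_def min_def split: if_splits)
qed

lemma absv_diff_le: "absv (f - g) \<le> max (absv f) (absv g)"
  using absv_add_le[of f "- g"] by simp

lemma absv_diff_less: "absv f < r \<Longrightarrow> absv g < r \<Longrightarrow> absv (f - g) < r"
  using absv_diff_le[of f g] by linarith

lemma absv_add_eq: "absv f < absv g \<Longrightarrow> absv (f + g) = absv g"
  using absv_add_le[of f g] absv_diff_le[of "f + g" f] by simp

lemma absv_add_eq': "absv g < absv f \<Longrightarrow> absv (f + g) = absv f"
  using absv_add_eq[of g f] by (simp add: add.commute)

lemma absv_diff_eq: "absv f < absv g \<Longrightarrow> absv (f - g) = absv g"
  using absv_add_eq[of f "- g"] by simp

lemma absv_diff_eq': "absv g < absv f \<Longrightarrow> absv (f - g) = absv f"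
  using absv_diff_eq[of g f] by (simp add: absv_minus_commute)

lemma absv_cong: "absv (f - g) < absv f \<Longrightarrow> absv g = absv f"
  using absv_diff_eq'[of "f - g" f] by (simp add: absv_minus_commute)

lemma absv_diff_triangle: "absv (f - h) \<le> max (absv (f - g)) (absv (g - h))"
  using absv_add_le[of "f - g" "g - h"] by simp

lemma absv_le_iff:
  fixes f g :: "'a::{finite,field} fls"
  shows "f \<noteq> 0 \<Longrightarrow> g \<noteq> 0 \<Longrightarrow> absv f \<le> absv g \<longleftrightarrow> fls_subdegree g \<le> fls_subdegree f"
  by (simp add: absv_nz)

lemma absv_less_iff:
  fixes f g :: "'a::{finite,field} fls"
  shows "f \<noteq> 0 \<Longrightarrow> g \<noteq> 0 \<Longrightarrow> absv f < absv g \<longleftrightarrow> fls_subdegree g < fls_subdegree f"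
  by (simp add: absv_nz)

text \<open>Bounds become vanishing of coefficients, so that finiteness of bounded sets of
  polynomials and completeness can be checked coefficient by coefficient.\<close>

lemma absv_less_powr_iff:
  "absv (f::'a::{finite,field} fls) < real CARD('a) powr (- real_of_int k) \<longleftrightarrow> (\<forall>i\<le>k. fls_nth f i = 0)"
proof (cases "f = 0")
  case True
  thus ?thesis using card_gt_one[where 'a='a] by simp
next
  case False
  have "absv f < real CARD('a) powr (- real_of_int k) \<longleftrightarrow> k < fls_subdegree f"
    using False by (simp add: absv_nz)
  also have "\<dots> \<longleftrightarrow> (\<forall>i\<le>k. fls_nth f i = 0)"
    using False nth_fls_subdegree_nonzero[OF False]
    by (metis fls_eq0_below_subdegree not_le order.strict_trans1)
  finally show ?thesis .
qed

lemma absv_less_one_iff: "absv f < 1 \<longleftrightarrow> (\<forall>i\<le>0. fls_nth f i = 0)"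
  using absv_less_powr_iff[of f 0] card_gt_one[where 'a='a] by simp

text \<open>The value group is discrete, with a gap between 1/q and 1. This gap is the source of the
  growth and contraction factors q below.\<close>

lemma absv_less_one: "absv (f::'a::{finite,field} fls) < 1 \<Longrightarrow> absv f \<le> 1 / real CARD('a)"
proof (cases "f = 0")
  case False
  assume "absv f < 1"
  hence "absv f < absv 1" by simp
  hence "1 \<le> fls_subdegree f" using False by (subst (asm) absv_less_iff) auto
  hence "absv f \<le> real CARD('a) powr (- 1)"
    using False by (simp only: absv_nz[OF False] card_powr_le_iff)
  thus ?thesis by (simp add: powr_minus inverse_eq_divide)
qed simp

lemma absv_gt_one: "1 < absv (f::'a::{finite,field} fls) \<Longrightarrow> real CARD('a) \<le> absv f"
proof -
  assume *: "1 < absv f"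
  hence "f \<noteq> 0" by auto
  have "absv (inverse f) < 1" using * by (subst absv_inverse) (simp add: inverse_less_1_iff)
  hence "absv (inverse f) \<le> 1 / real CARD('a)" by (rule absv_less_one)
  hence "inverse (absv f) \<le> inverse (real CARD('a))" by (metis absv_inverse inverse_eq_divide)
  thus ?thesis using \<open>f \<noteq> 0\<close> by (intro inverse_le_imp_le[of "absv f"]) auto
qed

section \<open>Polynomials and rational functions\<close>

lemma Rpoly_0 [simp]: "0 \<in> Rpoly" and Rpoly_1 [simp]: "1 \<in> Rpoly"
  by (auto simp: Rpoly_def)

lemma Rpoly_uminus [intro]: "f \<in> Rpoly \<Longrightarrow> - f \<in> Rpoly"
  by (auto simp: Rpoly_def)

lemma Rpoly_add [intro]: "f \<in> Rpoly \<Longrightarrow> g \<in> Rpoly \<Longrightarrow> f + g \<in> Rpoly"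
  by (auto simp: Rpoly_def)

lemma Rpoly_diff [intro]: "f \<in> Rpoly \<Longrightarrow> g \<in> Rpoly \<Longrightarrow> f - g \<in> Rpoly"
  by (auto simp: Rpoly_def)

lemma Rpoly_mult [intro]:
  assumes "f \<in> Rpoly" "g \<in> Rpoly" shows "f * g \<in> Rpoly"
  unfolding Rpoly_def
proof (intro CollectI allI impI)
  fix n :: int assume "0 < n"
  have "fls_nth f i * fls_nth g (n - i) = 0" for i
    using assms \<open>0 < n\<close> by (cases "i > 0") (auto simp: Rpoly_def)
  thus "fls_nth (f * g) n = 0"
    by (simp only: fls_times_nth(2) sum.neutral_const)
qed

lemma Rpoly_power [intro]: "f \<in> Rpoly \<Longrightarrow> f ^ n \<in> Rpoly"
  by (induction n) auto

lemma Rpoly_2 [simp]: "2 \<in> Rpoly"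
  using Rpoly_add[of 1 1] by simp

lemma Rpoly_X_inv [simp]: "fls_X_inv ^ n \<in> Rpoly"
  by (auto simp: Rpoly_def)

lemma absv_X_inv_power: "absv (fls_X_inv ^ n :: 'a::{finite,field} fls) = real CARD('a) powr real n"
  by (simp add: absv_nz)

text \<open>The integrality principle behind the lower bounds: absolute value less than 1 kills the
  coefficients of index at most 0, membership in \<open>Rpoly\<close> kills the others.\<close>

lemma absv_Rpoly_ge_one:
  assumes "f \<in> Rpoly" "f \<noteq> 0" shows "1 \<le> absv f"
  using assms absv_less_one_iff[of f] by (force simp: Rpoly_def fls_eq_iff not_less[symmetric])

lemma absv_Rpoly_unit:
  fixes r :: "'a::{finite,field} fls"
  assumes "r \<in> Rpoly" "u \<in> Rpoly" "r * u = 1" shows "absv r = 1"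
proof -
  have "r \<noteq> 0" "u \<noteq> 0" using assms by auto
  hence "1 \<le> absv r" "1 \<le> absv u" using assms absv_Rpoly_ge_one by auto
  moreover have "absv r * absv u = 1" using assms by (metis absv_1 absv_mult)
  moreover have "absv r * 1 \<le> absv r * absv u" using \<open>1 \<le> absv u\<close> by (intro mult_left_mono) auto
  ultimately show ?thesis by simp
qed

lemma fls_nth_polypart [simp]: "fls_nth (polypart f) n = (if n \<le> 0 then fls_nth f n else 0)"
  unfolding polypart_def
  by (rule nth_Abs_fls_lower_bound[of "fls_subdegree f"]) auto

lemma polypart_Rpoly [simp]: "polypart f \<in> Rpoly"
  by (simp add: Rpoly_def)

lemma absv_diff_polypart: "absv (f - polypart f) < 1"
  by (simp add: absv_less_one_iff)

lemma finite_Rpoly_bounded: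
  "finite {f \<in> Rpoly :: 'a::{finite,field} fls set. absv f \<le> B}"
proof -
  obtain n :: nat where "B < real CARD('a) ^ n"
    using real_arch_pow[OF card_gt_one[where 'a='a]] by blast
  hence n: "B < real CARD('a) powr (- real_of_int (- int n))"
    using card_gt_one[where 'a='a] by (simp add: powr_realpow)
  let ?S = "{f \<in> Rpoly :: 'a fls set. absv f \<le> B}"
  \<comment> \<open>The coefficients of Y^0, ..., Y^(n-1) determine a polynomial of absolute value
    less than q^n.\<close>
  let ?r = "\<lambda>f::'a fls. map (\<lambda>i. fls_nth f (- int i)) [0..<n]"
  have "inj_on ?r ?S"
  proof (rule inj_onI)
    fix f g assume fg: "f \<in> ?S" "g \<in> ?S" "?r f = ?r g"
    show "f = g" unfolding fls_eq_iff
    proof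
      fix k :: int
      consider "k > 0" | "k \<le> - int n" | "k \<le> 0" "k > - int n" by linarith
      thus "fls_nth f k = fls_nth g k"
      proof cases
        case 1 thus ?thesis using fg by (simp add: Rpoly_def)
      next
        case 2
        have "absv f < real CARD('a) powr (- real_of_int (- int n))"
             "absv g < real CARD('a) powr (- real_of_int (- int n))"
          using fg n by auto
        thus ?thesis using 2 unfolding absv_less_powr_iff by simp
      next
        case 3
        hence "nat (- k) < n" by auto
        moreover have "\<forall>i<n. fls_nth f (- int i) = fls_nth g (- int i)" using fg by auto
        ultimately have "fls_nth f (- int (nat (- k))) = fls_nth g (- int (nat (- k)))" by blast
        thus ?thesis using 3 by simp
      qed
    qed
  qed
  moreover have "?r ` ?S \<subseteq> {xs. set xs \<subseteq> UNIV \<and> length xs = n}" by auto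
  hence "finite (?r ` ?S)" by (rule finite_subset) (rule finite_lists_length_eq, simp)
  ultimately show ?thesis using finite_imageD by blast
qed

lemma KfracI: "P \<in> Rpoly \<Longrightarrow> Q \<in> Rpoly \<Longrightarrow> Q \<noteq> 0 \<Longrightarrow> P / Q \<in> Kfrac"
  by (auto simp: Kfrac_def)

lemma KfracE:
  assumes "f \<in> Kfrac" obtains P Q where "P \<in> Rpoly" "Q \<in> Rpoly" "Q \<noteq> 0" "f = P / Q"
  using assms by (auto simp: Kfrac_def)

lemma Rpoly_Kfrac: "f \<in> Rpoly \<Longrightarrow> f \<in> Kfrac"
  using KfracI[of f 1] by simp

lemma Kfrac_0 [simp]: "0 \<in> Kfrac" and Kfrac_1 [simp]: "1 \<in> Kfrac"
  by (auto intro: Rpoly_Kfrac)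

lemma Kfrac_uminus [intro]: "f \<in> Kfrac \<Longrightarrow> - f \<in> Kfrac"
  by (elim KfracE) (metis KfracI Rpoly_uminus minus_divide_left)

lemma Kfrac_add [intro]: "f \<in> Kfrac \<Longrightarrow> g \<in> Kfrac \<Longrightarrow> f + g \<in> Kfrac"
  by (elim KfracE) (auto simp: add_frac_eq intro!: KfracI)

lemma Kfrac_diff [intro]: "f \<in> Kfrac \<Longrightarrow> g \<in> Kfrac \<Longrightarrow> f - g \<in> Kfrac"
  using Kfrac_add[of f "- g"] by auto

lemma Kfrac_mult [intro]: "f \<in> Kfrac \<Longrightarrow> g \<in> Kfrac \<Longrightarrow> f * g \<in> Kfrac"
  by (elim KfracE) (auto intro!: KfracI)

lemma Kfrac_inverse [intro]: "f \<in> Kfrac \<Longrightarrow> inverse f \<in> Kfrac"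
proof (cases "f = 0")
  case False
  assume "f \<in> Kfrac"
  then obtain P Q where "P \<in> Rpoly" "Q \<in> Rpoly" "Q \<noteq> 0" "f = P / Q" by (rule KfracE)
  with False KfracI[of Q P] show ?thesis by auto
qed simp

lemma Kfrac_divide [intro]: "f \<in> Kfrac \<Longrightarrow> g \<in> Kfrac \<Longrightarrow> f / g \<in> Kfrac"
  unfolding divide_inverse by (intro Kfrac_mult Kfrac_inverse)

section \<open>Conjugates and homographies\<close>

text \<open>Conjugacy through trace and norm, so that no minimal polynomial has to be chosen;
  \<open>x \<noteq> y\<close> expresses separability.\<close>

definition conjp :: "'a::field fls \<Rightarrow> 'a fls \<Rightarrow> bool" where
  "conjp x y \<longleftrightarrow> x \<notin> Kfrac \<and> x \<noteq> y \<and> x + y \<in> Kfrac \<and> x * y \<in> Kfrac"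

definition gl2 :: "'a::field fls \<Rightarrow> 'a fls \<Rightarrow> 'a fls \<Rightarrow> 'a fls \<Rightarrow> bool" where
  "gl2 a b c d \<longleftrightarrow> a \<in> Rpoly \<and> b \<in> Rpoly \<and> c \<in> Rpoly \<and> d \<in> Rpoly \<and> (\<exists>u\<in>Rpoly. (a * d - b * c) * u = 1)"

text \<open>Homographies are evaluated at irrational points, where \<open>gl2_denom_nonzero\<close>
  keeps the denominator nonzero; the point at infinity never enters.\<close>

definition mob :: "'a::field fls \<Rightarrow> 'a fls \<Rightarrow> 'a fls \<Rightarrow> 'a fls \<Rightarrow> 'a fls \<Rightarrow> 'a fls" where
  "mob a b c d x = (a * x + b) / (c * x + d)"

lemma linear_nonzero:
  assumes "x \<notin> Kfrac" "c \<in> Rpoly" "d \<in> Rpoly" "c \<noteq> 0 \<or> d \<noteq> 0"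
  shows "d + c * x \<noteq> 0"
proof
  assume *: "d + c * x = 0"
  with assms have "c \<noteq> 0" by auto
  have "x * c = - d" using * by (simp add: eq_neg_iff_add_eq_0 algebra_simps)
  hence "x = (- d) / c" by (simp only: nonzero_eq_divide_eq[OF \<open>c \<noteq> 0\<close>])
  with assms show False by (metis KfracI Rpoly_uminus \<open>c \<noteq> 0\<close>)
qed

lemma gl2_denom_nonzero:
  assumes "gl2 a b c d" "x \<notin> Kfrac"
  shows "c * x + d \<noteq> 0"
proof -
  have "c \<noteq> 0 \<or> d \<noteq> 0" "c \<in> Rpoly" "d \<in> Rpoly" using assms(1) by (auto simp: gl2_def)
  thus ?thesis using linear_nonzero[OF assms(2), of c d] by (simp add: add.commute)
qed

lemma conjpD:
  assumes "conjp x y" shows "x \<notin> Kfrac" "y \<notin> Kfrac" "x \<noteq> y" "x + y \<in> Kfrac" "x * y \<in> Kfrac"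
  using assms Kfrac_diff[of "x + y" y] unfolding conjp_def by auto

lemma conjp_sym: "conjp x y \<Longrightarrow> conjp y x"
  using conjpD[of x y] unfolding conjp_def add.commute[of y] mult.commute[of y] by blast

text \<open>Two quadratic relations with different root sums would combine to a linear one and make
  x rational. Hence \<open>qconj\<close> does not depend on the relation that \<open>SOME\<close>
  picks.\<close>

lemma qconj_root_sum:
  assumes "x \<notin> Kfrac" "a \<in> Kfrac" "b \<in> Kfrac" "c \<in> Kfrac" "a \<noteq> 0" "a * x^2 + b * x + c = 0"
    and "s \<in> Kfrac" "p \<in> Kfrac" "x^2 = s * x - p"
  shows "s = - b / a"
proof (rule ccontr)
  assume "s \<noteq> - b / a"
  hence nz: "a * s + b \<noteq> 0" using assms(5) by (auto simp: field_simps eq_neg_iff_add_eq_0)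
  have "a * (s * x - p) + b * x + c = 0" using assms by simp
  hence "(a * s + b) * x = a * p - c" by (simp add: algebra_simps)
  hence "x = (a * p - c) / (a * s + b)" using nz by (simp add: field_simps)
  also have "\<dots> \<in> Kfrac" using assms by auto
  finally show False using assms by simp
qed

lemma qconj_eq:
  assumes "x \<notin> Kfrac" "s \<in> Kfrac" "p \<in> Kfrac" "x^2 = s * x - p"
  shows "qconj x = s - x"
proof -
  let ?P = "\<lambda>(a, b, c). a \<in> Kfrac \<and> b \<in> Kfrac \<and> c \<in> Kfrac \<and> a \<noteq> 0 \<and> a * x^2 + b * x + c = 0"
  have "?P (1, - s, p)" using assms by (auto simp: algebra_simps)
  hence "?P (Eps ?P)" by (rule someI)
  moreover obtain a b c where abc: "Eps ?P = (a, b, c)" by (cases "Eps ?P") auto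
  ultimately have "s = - b / a" using qconj_root_sum[of x a b c s p] assms by auto
  thus ?thesis unfolding qconj_def abc by simp
qed

lemma conjp_qconj: "conjp x y \<Longrightarrow> qconj x = y"
  using qconj_eq[of x "x + y" "x * y"] conjpD[of x y] by (simp add: algebra_simps power2_eq_square)

text \<open>Separability: in characteristic 2 the polynomial part of \<open>y\<close> and its remainder \<open>r\<close> satisfy
  \<open>y\<^sup>2 = p\<^sup>2 + r\<^sup>2\<close>, so \<open>r\<^sup>2\<close> is a polynomial of absolute value less than 1.\<close>

lemma Rpoly_if_square:
  assumes two: "(2::'a::{finite,field} fls) = 0" and y: "y^2 \<in> Rpoly"
  shows "(y::'a fls) \<in> Rpoly"
proof -
  define p r where "p = polypart y" and "r = y - p"
  have "y = p + r" by (simp add: r_def)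
  hence "y^2 = p^2 + r^2 + 2 * p * r" by (simp add: power2_eq_square algebra_simps)
  hence "r^2 = y^2 - p^2" by (simp add: two)
  hence R: "r^2 \<in> Rpoly" using y Rpoly_power[of p 2] by (auto simp: p_def)
  have "absv r < 1" by (simp add: r_def p_def absv_diff_polypart)
  hence "absv (r^2) < 1" by (simp add: absv_power power_less_one_iff)
  hence "r^2 = 0" using R absv_Rpoly_ge_one[OF R] by fastforce
  thus ?thesis using polypart_Rpoly[of y] by (simp add: r_def p_def)
qed

text \<open>The issue is separability. A double root is half its trace, hence rational, outside
  characteristic 2; in characteristic 2 its square is rational, and clearing denominators leads to
  \<open>Rpoly_if_square\<close>.\<close>

lemma K2_conjp:
  assumes "(x::'a::{finite,field} fls) \<in> K2" shows "conjp x (qconj x)"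
proof -
  from assms obtain a b c where abc: "x \<notin> Kfrac" "a \<in> Kfrac" "b \<in> Kfrac" "c \<in> Kfrac" "a \<noteq> 0"
    "a * x^2 + b * x + c = 0"
    by (auto simp: K2_def)
  define s p where "s = - b / a" and "p = c / a"
  have sp: "s \<in> Kfrac" "p \<in> Kfrac" using abc by (auto simp: s_def p_def)
  have "a * x^2 = - b * x - c" using abc(6) by (simp add: algebra_simps eq_neg_iff_add_eq_0)
  hence "x^2 = (- b * x - c) / a" by (simp only: nonzero_eq_divide_eq[OF abc(5)] mult.commute)
  hence eq: "x^2 = s * x - p" by (simp add: s_def p_def diff_divide_distrib)
  have q: "qconj x = s - x" using qconj_eq[OF abc(1) sp eq] .
  have "x \<noteq> qconj x"
  proof
    assume "x = qconj x"
    hence s: "s = 2 * x" by (simp add: q)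
    have two: "(2::'a fls) = 0"
    proof (rule ccontr)
      assume "(2::'a fls) \<noteq> 0"
      hence "x = s / 2" by (simp add: s)
      moreover have "2 \<in> Kfrac" using Kfrac_add[of 1 1] by simp
      ultimately show False using abc(1) Kfrac_divide[of s 2] sp by metis
    qed
    have "x^2 = - p" using eq s two by simp
    then obtain P Q where PQ: "P \<in> Rpoly" "Q \<in> Rpoly" "Q \<noteq> 0" "x^2 = P / Q"
      using sp(2) by (metis KfracE Kfrac_uminus)
    have "(x * Q)^2 = P * Q" using PQ by (simp only: power_mult_distrib) (simp add: power2_eq_square)
    hence "(x * Q)^2 \<in> Rpoly" using PQ by auto
    hence "x * Q \<in> Rpoly" by (rule Rpoly_if_square[OF two])
    hence "x * Q / Q \<in> Kfrac" using PQ by (intro KfracI)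
    thus False using abc(1) PQ(3) by simp
  qed
  moreover have "x * qconj x = p" using eq by (simp add: q algebra_simps power2_eq_square)
  ultimately show ?thesis using abc(1) sp by (simp add: conjp_def q)
qed

lemma mob_diff:
  assumes "c * x + d \<noteq> 0" "c * y + d \<noteq> 0"
  shows "mob a b c d x - mob a b c d y = (a * d - b * c) * (x - y) / ((c * x + d) * (c * y + d))"
  using assms by (simp add: mob_def diff_frac_eq) (simp add: algebra_simps)

lemma gl2_det_nonzero: "gl2 a b c d \<Longrightarrow> a * d - b * c \<noteq> 0"
  by (auto simp: gl2_def)

lemma conjp_mob:
  assumes g: "gl2 a b c d" and xy: "conjp x y"
  shows "conjp (mob a b c d x) (mob a b c d y)"
proof -
  note D = conjpD[OF xy]
  have R: "a \<in> Kfrac" "b \<in> Kfrac" "c \<in> Kfrac" "d \<in> Kfrac"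
    using g by (auto simp: gl2_def intro: Rpoly_Kfrac)
  have nz: "c * x + d \<noteq> 0" "c * y + d \<noteq> 0" using gl2_denom_nonzero[OF g] D by auto
  have det: "a * d - b * c \<noteq> 0" using g by (rule gl2_det_nonzero)
  have "mob a b c d x \<notin> Kfrac"
  proof
    assume r: "mob a b c d x \<in> Kfrac"
    define r where "r = mob a b c d x"
    have "a * x + b = r * (c * x + d)" using nz by (simp add: r_def mob_def)
    hence *: "(a - r * c) * x = r * d - b" by (simp add: algebra_simps)
    show False
    proof (cases "a - r * c = 0")
      case True
      with * have "a = r * c" "b = r * d" by auto
      thus False using det by (simp add: algebra_simps)
    next
      case False
      with * have "x = (r * d - b) / (a - r * c)" by (simp add: field_simps)
      thus False using D(1) r R by (metis r_def Kfrac_diff Kfrac_divide Kfrac_mult)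
    qed
  qed
  moreover have ne: "mob a b c d x \<noteq> mob a b c d y"
    using mob_diff[OF nz, of a b] nz det D(3) by auto
  \<comment> \<open>The product of the denominators is a norm, symmetric in x and y, hence in K. The
    numerators of the sum and product of the images are symmetric as well.\<close>
  have N: "(c * x + d) * (c * y + d) = c * c * (x * y) + c * d * (x + y) + d * d"
    by (simp add: algebra_simps)
  moreover have "(c * x + d) * (c * y + d) \<in> Kfrac" unfolding N by (intro Kfrac_add Kfrac_mult R D)
  moreover have "mob a b c d x + mob a b c d y =
      (2 * (a * c * (x * y)) + (a * d + b * c) * (x + y) + 2 * (b * d)) / ((c * x + d) * (c * y + d))"
    using nz by (simp add: mob_def add_frac_eq) (simp add: algebra_simps)
  moreover have "mob a b c d x * mob a b c d y =
      (a * a * (x * y) + a * b * (x + y) + b * b) / ((c * x + d) * (c * y + d))"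
    using nz by (simp add: mob_def) (simp add: algebra_simps)
  moreover have two: "2 \<in> Kfrac" using Kfrac_add[of 1 1] by simp
  have "2 * (a * c * (x * y)) + (a * d + b * c) * (x + y) + 2 * (b * d) \<in> Kfrac"
       "a * a * (x * y) + a * b * (x + y) + b * b \<in> Kfrac"
    by (intro Kfrac_add Kfrac_mult two R D)+
  ultimately show ?thesis using ne by (simp add: conjp_def Kfrac_divide)
qed

lemma mob_mob:
  assumes "c' * x + d' \<noteq> 0"
  shows "mob a b c d (mob a' b' c' d' x) =
    mob (a * a' + b * c') (a * b' + b * d') (c * a' + d * c') (c * b' + d * d') x"
proof -
  have "a * mob a' b' c' d' x + b = (a * (a' * x + b') + b * (c' * x + d')) / (c' * x + d')"
       "c * mob a' b' c' d' x + d = (c * (a' * x + b') + d * (c' * x + d')) / (c' * x + d')"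
    using assms by (simp_all add: mob_def field_simps)
  thus ?thesis using assms by (simp add: mob_def) (simp add: algebra_simps)
qed

lemma gl2_mult:
  assumes "gl2 a b c d" "gl2 a' b' c' d'"
  shows "gl2 (a * a' + b * c') (a * b' + b * d') (c * a' + d * c') (c * b' + d * d')"
proof -
  obtain u u' where u: "u \<in> Rpoly" "u' \<in> Rpoly" "(a * d - b * c) * u = 1" "(a' * d' - b' * c') * u' = 1"
    using assms by (auto simp: gl2_def)
  have "((a * a' + b * c') * (c * b' + d * d') - (a * b' + b * d') * (c * a' + d * c')) * (u * u')
      = ((a * d - b * c) * u) * ((a' * d' - b' * c') * u')"
    by (simp add: algebra_simps)
  also have "\<dots> = 1" by (simp add: u)
  finally show ?thesis using assms u by (auto simp: gl2_def)
qed

section \<open>The orbit under homographies and conjugation\<close>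

lemma Theta_eq:
  assumes "conjp \<alpha> \<alpha>'"
  shows "Theta \<alpha> = {mob a b c d \<beta> | a b c d \<beta>. gl2 a b c d \<and> \<beta> \<in> {\<alpha>, \<alpha>'}}"
  unfolding Theta_def mob_def gl2_def conjp_qconj[OF assms] by blast

lemma ThetaI:
  assumes "conjp \<alpha> \<alpha>'" "gl2 a b c d" "\<beta> = \<alpha> \<or> \<beta> = \<alpha>'"
  shows "mob a b c d \<beta> \<in> Theta \<alpha>"
  unfolding Theta_eq[OF assms(1)] using assms by blast

text \<open>Conjugation commutes with homographies over R: the same matrix moves the other starting
  point to the conjugate.\<close>

lemma ThetaE:
  assumes "conjp \<alpha> \<alpha>'" "x \<in> Theta \<alpha>"
  obtains a b c d where "gl2 a b c d" "x = mob a b c d \<alpha>" "qconj x = mob a b c d \<alpha>'"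
  | a b c d where "gl2 a b c d" "x = mob a b c d \<alpha>'" "qconj x = mob a b c d \<alpha>"
proof -
  obtain a b c d \<beta> where g: "gl2 a b c d" "\<beta> \<in> {\<alpha>, \<alpha>'}" "x = mob a b c d \<beta>"
    using assms(2) unfolding Theta_eq[OF assms(1)] by blast
  show thesis
    using g that conjp_qconj[OF conjp_mob[OF g(1) assms(1)]]
      conjp_qconj[OF conjp_mob[OF g(1) conjp_sym[OF assms(1)]]] by auto
qed

lemma Theta_conjp:
  assumes "conjp \<alpha> \<alpha>'" "x \<in> Theta \<alpha>"
  shows "conjp x (qconj x)"
  using assms(2) by (rule ThetaE[OF assms(1)]) (auto intro: conjp_mob assms(1) conjp_sym)

lemma Theta_mob:
  assumes "conjp \<alpha> \<alpha>'" "x \<in> Theta \<alpha>" "gl2 a b c d"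
  shows "mob a b c d x \<in> Theta \<alpha>"
proof -
  obtain a' b' c' d' \<beta> where g: "gl2 a' b' c' d'" "\<beta> \<in> {\<alpha>, \<alpha>'}" "x = mob a' b' c' d' \<beta>"
    using assms(2) unfolding Theta_eq[OF assms(1)] by blast
  hence "\<beta> \<notin> Kfrac" using conjpD[OF assms(1)] by auto
  hence "c' * \<beta> + d' \<noteq> 0" using g by (intro gl2_denom_nonzero)
  thus ?thesis using g gl2_mult[OF assms(3) g(1)] mob_mob unfolding Theta_eq[OF assms(1)] by blast
qed

lemma Theta_qconj:
  assumes "conjp \<alpha> \<alpha>'" "x \<in> Theta \<alpha>"
  shows "qconj x \<in> Theta \<alpha>"
  using assms(2) by (rule ThetaE[OF assms(1)]) (simp_all add: ThetaI[OF assms(1)])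

lemma Theta_self:
  assumes "conjp \<alpha> \<alpha>'" shows "\<alpha> \<in> Theta \<alpha>"
proof -
  have "mob 1 0 0 1 \<alpha> = \<alpha>" "gl2 1 0 0 1" by (auto simp: mob_def gl2_def)
  thus ?thesis using ThetaI[OF assms, of 1 0 0 1 \<alpha>] by simp
qed

text \<open>The adjugate serves as inverse matrix, since scalars act trivially and its determinant
  is the same unit.\<close>

lemma mob_adjugate:
  assumes "gl2 a b c d" "c * x + d \<noteq> 0"
  shows "mob d (- b) (- c) a (mob a b c d x) = x" "gl2 d (- b) (- c) a"
proof -
  have "mob d (- b) (- c) a (mob a b c d x) = (a * d - b * c) * x / (a * d - b * c)"
    by (subst mob_mob[OF assms(2)]) (simp add: mob_def algebra_simps)
  thus "mob d (- b) (- c) a (mob a b c d x) = x" using gl2_det_nonzero[OF assms(1)] by simp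
  show "gl2 d (- b) (- c) a" using assms(1) by (auto simp: gl2_def algebra_simps)
qed

lemma Theta_mem_sym:
  assumes "conjp \<alpha> \<alpha>'" "x \<in> Theta \<alpha>" shows "\<alpha> \<in> Theta x"
proof -
  note c = Theta_conjp[OF assms] conjp_sym[OF Theta_conjp[OF assms]]
  have "\<alpha> \<in> Theta x" if "gl2 a b c d" "\<beta> \<in> {x, qconj x}" "\<beta> = mob a b c d \<alpha>" for a b c d \<beta>
  proof -
    note * = mob_adjugate[OF that(1) gl2_denom_nonzero[OF that(1) conjpD(1)[OF assms(1)]]]
    from *(1) have "\<alpha> = mob d (- b) (- c) a \<beta>" using that(3) by simp
    with *(2) that(2) show ?thesis unfolding Theta_eq[OF c(1)] by blast
  qed
  from assms(2) this show ?thesis by (elim ThetaE[OF assms(1)]) auto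
qed

lemma Theta_subset:
  assumes "conjp \<alpha> \<alpha>'" "x \<in> Theta \<alpha>" shows "Theta x \<subseteq> Theta \<alpha>"
proof
  fix y assume "y \<in> Theta x"
  thus "y \<in> Theta \<alpha>"
    by (rule ThetaE[OF Theta_conjp[OF assms]])
      (simp_all add: Theta_mob[OF assms(1)] assms(2) Theta_qconj[OF assms])
qed

text \<open>Allows \<alpha> to be replaced by the inverse of a complete quotient inside the
  period.\<close>

lemma Theta_cong:
  assumes "conjp \<alpha> \<alpha>'" "x \<in> Theta \<alpha>" shows "Theta x = Theta \<alpha>"
  using Theta_subset[OF assms] Theta_subset[OF Theta_conjp[OF assms] Theta_mem_sym[OF assms]] by blast

section \<open>Quadratic forms of a fixed discriminant\<close>

text \<open>The pairs \<open>(x, x')\<close> of roots of quadratic polynomials over \<open>R\<close> with leading coefficient \<open>A\<close> and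
  \<open>A (x - x') = \<omega> - \<omega>'\<close>, a fixed square root of the discriminant. Working with \<open>A x - \<omega> \<in> R\<close> instead of
  the discriminant avoids any division by 2.\<close>

definition qf :: "'a::field fls \<Rightarrow> 'a fls \<Rightarrow> 'a fls \<Rightarrow> 'a fls \<Rightarrow> bool" where
  "qf \<omega> \<omega>' x x' \<longleftrightarrow> (\<exists>A\<in>Rpoly. \<exists>w\<in>Rpoly. A \<noteq> 0 \<and> A * x = \<omega> + w \<and> A * x' = \<omega>' + w \<and> A * x * x' \<in> Rpoly)"

lemma qfE:
  assumes "qf \<omega> \<omega>' x x'"
  obtains A w where "A \<in> Rpoly" "w \<in> Rpoly" "A \<noteq> 0" "A * x = \<omega> + w" "A * x' = \<omega>' + w" "A * x * x' \<in> Rpoly"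
  using assms unfolding qf_def by blast

text \<open>Clearing the denominators of trace and norm gives an integral form; its roots times the
  leading coefficient serve as \<open>\<omega>\<close> and \<open>\<omega>'\<close>, with shift
  0.\<close>

lemma qf_exists:
  assumes "conjp x y"
  obtains A where "A \<in> Rpoly" "A \<noteq> 0" "A * x + A * y \<in> Rpoly" "qf (A * x) (A * y) x y"
proof -
  obtain P Q where PQ: "P \<in> Rpoly" "Q \<in> Rpoly" "Q \<noteq> 0" "x + y = P / Q"
    using conjpD(4)[OF assms] by (rule KfracE)
  obtain S T where ST: "S \<in> Rpoly" "T \<in> Rpoly" "T \<noteq> 0" "x * y = S / T"
    using conjpD(5)[OF assms] by (rule KfracE)
  have "Q * T * x + Q * T * y = Q * T * (x + y)" by (simp only: distrib_left)
  also have "\<dots> = P * T" using PQ by simp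
  finally have 1: "Q * T * x + Q * T * y \<in> Rpoly" using PQ ST by auto
  have "Q * T * x * y = Q * T * (x * y)" by (simp only: mult.assoc)
  also have "\<dots> = Q * S" using ST by simp
  finally have 2: "Q * T * x * y \<in> Rpoly" using Rpoly_mult[OF PQ(2) ST(1)] by (simp only:)
  have "qf (Q * T * x) (Q * T * y) x y"
    unfolding qf_def using 2 PQ ST by (intro bexI[of _ "Q * T"] bexI[of _ 0]) auto
  thus ?thesis using 1 PQ ST by (intro that[of "Q * T"]) auto
qed

text \<open>Invariance of the discriminant. The new leading coefficient is A times the norm of c x +
  d, times the inverse \<open>e\<close> of the determinant; this last factor fixes the square root
  \<open>\<omega> - \<omega>'\<close> itself, not merely up to a unit.\<close>

lemma qf_mob:
  assumes x: "qf \<omega> \<omega>' x x'" and tr: "\<omega> + \<omega>' \<in> Rpoly" and g: "gl2 a b c d"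
    and nz: "c * x + d \<noteq> 0" "c * x' + d \<noteq> 0"
  shows "qf \<omega> \<omega>' (mob a b c d x) (mob a b c d x')"
proof -
  obtain A w where A: "A \<in> Rpoly" "w \<in> Rpoly" "A \<noteq> 0" "A * x = \<omega> + w" "A * x' = \<omega>' + w"
      "A * x * x' \<in> Rpoly"
    using x by (rule qfE)
  from g obtain e where e: "e \<in> Rpoly" "(a * d - b * c) * e = 1"
    and R: "a \<in> Rpoly" "b \<in> Rpoly" "c \<in> Rpoly" "d \<in> Rpoly"
    by (auto simp: gl2_def)
  define C T where "C = A * x * x'" and "T = A * x + A * x'"
  have "T = (\<omega> + \<omega>') + 2 * w" by (simp add: T_def A)
  hence T: "T \<in> Rpoly" by (elim ssubst) (intro Rpoly_add Rpoly_mult Rpoly_2 A tr)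
  have C: "C \<in> Rpoly" using A by (simp add: C_def)
  define B where "B = e * (A * ((c * x + d) * (c * x' + d)))"
  define v where "v = e * (a * c * C + b * d * A + b * c * T)"
  have "e \<noteq> 0" using e by auto
  hence "B \<noteq> 0" using nz A by (simp add: B_def)
  have B: "B = e * (c * c * C + c * d * T + d * d * A)"
    by (simp add: B_def C_def T_def algebra_simps)
  have v: "v \<in> Rpoly" unfolding v_def by (intro Rpoly_add Rpoly_mult R e A C T)
  have "B * mob a b c d x = e * (A * ((a * x + b) * (c * x' + d)))"
    using nz by (simp add: B_def mob_def)
  also have "\<dots> = v + ((a * d - b * c) * e) * (A * x)"
    by (simp add: v_def C_def T_def algebra_simps)
  finally have 1: "B * mob a b c d x = \<omega> + (w + v)" using e A by simp
  have "B * mob a b c d x' = e * (A * ((a * x' + b) * (c * x + d)))"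
    using nz by (simp add: B_def mob_def)
  also have "\<dots> = v + ((a * d - b * c) * e) * (A * x')"
    by (simp add: v_def C_def T_def algebra_simps)
  finally have 2: "B * mob a b c d x' = \<omega>' + (w + v)" using e A by simp
  have "B * mob a b c d x * mob a b c d x' = e * (A * ((a * x + b) * (a * x' + b)))"
    using nz by (simp add: B_def mob_def)
  also have "\<dots> = e * (a * a * C + a * b * T + b * b * A)"
    by (simp add: C_def T_def algebra_simps)
  also have "\<dots> \<in> Rpoly" by (intro Rpoly_add Rpoly_mult R e A C T)
  finally have 3: "B * mob a b c d x * mob a b c d x' \<in> Rpoly" .
  have "B \<in> Rpoly" unfolding B by (intro Rpoly_add Rpoly_mult R e A C T)
  with 1 2 3 v A(2) \<open>B \<noteq> 0\<close> show ?thesis unfolding qf_def by blast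
qed

text \<open>Exchanging the roots negates their difference, so the leading coefficient changes sign
  and the trace of \<open>\<omega>\<close> corrects the shift.\<close>

lemma qf_swap:
  assumes x: "qf \<omega> \<omega>' x x'" and tr: "\<omega> + \<omega>' \<in> Rpoly"
  shows "qf \<omega> \<omega>' x' x"
proof -
  obtain A w where A: "A \<in> Rpoly" "w \<in> Rpoly" "A \<noteq> 0" "A * x = \<omega> + w" "A * x' = \<omega>' + w"
      "A * x * x' \<in> Rpoly"
    using x by (rule qfE)
  have "- A * x' = \<omega> + (- w - (\<omega> + \<omega>'))" "- A * x = \<omega>' + (- w - (\<omega> + \<omega>'))" using A by simp_all
  moreover have "- A * x' * x = - (A * x * x')" by simp
  hence "- A * x' * x \<in> Rpoly" using A by auto
  moreover have "- A \<in> Rpoly" "- w - (\<omega> + \<omega>') \<in> Rpoly" "- A \<noteq> 0" using A tr by auto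
  ultimately show ?thesis unfolding qf_def by blast
qed

lemma qf_diff_le:
  assumes "qf \<omega> \<omega>' x x'" shows "absv (x - x') \<le> absv (\<omega> - \<omega>')"
proof -
  obtain A w where A: "A \<in> Rpoly" "A \<noteq> 0" "A * x = \<omega> + w" "A * x' = \<omega>' + w"
    using assms by (rule qfE)
  have "\<omega> - \<omega>' = A * (x - x')" using A by (simp add: algebra_simps)
  hence "absv (\<omega> - \<omega>') = absv A * absv (x - x')" by (simp add: absv_mult)
  thus ?thesis using absv_Rpoly_ge_one[OF A(1,2)] mult_right_mono[of 1 "absv A" "absv (x - x')"] by simp
qed

text \<open>With leading coefficients \<open>A\<close> and \<open>B\<close>, the element \<open>A B (x - y) (x' - y')\<close> lies in \<open>R\<close>.\<close>

lemma qf_rigidity: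
  assumes x: "qf \<omega> \<omega>' x x'" and y: "qf \<omega> \<omega>' y y'" and tr: "\<omega> + \<omega>' \<in> Rpoly"
    and ne: "x \<noteq> y" "x' \<noteq> y'"
  shows "absv (x - x') * absv (y - y') \<le> absv (x - y) * absv (x' - y') * absv (\<omega> - \<omega>') ^ 2"
proof -
  obtain A w where A: "A \<in> Rpoly" "w \<in> Rpoly" "A \<noteq> 0" "A * x = \<omega> + w" "A * x' = \<omega>' + w"
      "A * x * x' \<in> Rpoly"
    using x by (rule qfE)
  obtain B v where B: "B \<in> Rpoly" "v \<in> Rpoly" "B \<noteq> 0" "B * y = \<omega> + v" "B * y' = \<omega>' + v"
      "B * y * y' \<in> Rpoly"
    using y by (rule qfE)
  have "\<omega> * \<omega>' = (A * x - w) * (A * x' - w)" using A by simp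
  also have "\<dots> = A * (A * x * x') - w * (A * x + A * x') + w * w" by (simp add: algebra_simps)
  also have "A * x + A * x' = (\<omega> + \<omega>') + 2 * w" using A by simp
  finally have nm: "\<omega> * \<omega>' \<in> Rpoly"
    by (elim ssubst) (intro Rpoly_add Rpoly_diff Rpoly_mult Rpoly_2 A tr)
  have "A * B * ((x - y) * (x' - y')) =
      B * (A * x * x') + A * (B * y * y') - ((A * x) * (B * y') + (A * x') * (B * y))"
    by (simp add: algebra_simps)
  \<comment> \<open>The mixed terms are symmetric under conjugation, so only the trace and the norm
    of \<open>\<omega>\<close> survive.\<close>
  also have "(A * x) * (B * y') + (A * x') * (B * y) =
      \<omega> * \<omega>' + \<omega> * \<omega>' + (w + v) * (\<omega> + \<omega>') + w * v + w * v"
    unfolding A B by (simp add: algebra_simps)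
  finally have "A * B * ((x - y) * (x' - y')) \<in> Rpoly"
    by (elim ssubst) (intro Rpoly_add Rpoly_diff Rpoly_mult A B nm tr)
  hence "1 \<le> absv (A * B * ((x - y) * (x' - y')))"
    using ne A B by (intro absv_Rpoly_ge_one) auto
  hence 1: "1 \<le> absv A * absv B * (absv (x - y) * absv (x' - y'))" by (simp add: absv_mult)
  have "\<omega> - \<omega>' = A * (x - x')" "\<omega> - \<omega>' = B * (y - y')" using A B by (simp_all add: algebra_simps)
  hence 2: "absv (\<omega> - \<omega>') = absv A * absv (x - x')" "absv (\<omega> - \<omega>') = absv B * absv (y - y')"
    by (simp_all only: absv_mult[symmetric])
  have "absv (x - x') * absv (y - y') * 1
      \<le> absv (x - x') * absv (y - y') * (absv A * absv B * (absv (x - y) * absv (x' - y')))"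
    using 1 by (intro mult_left_mono) auto
  also have "\<dots> = absv (x - y) * absv (x' - y') * ((absv A * absv (x - x')) * (absv B * absv (y - y')))"
    by (simp only: ac_simps)
  also have "\<dots> = absv (x - y) * absv (x' - y') * absv (\<omega> - \<omega>') ^ 2"
    by (simp only: 2[symmetric] power2_eq_square)
  finally show ?thesis by simp
qed

section \<open>Periodicity of the continued fraction\<close>

declare cf_rem.simps(2) [simp del]

text \<open>Subtracting a polynomial and inverting has determinant -1, so complete quotients never
  leave the orbit.\<close>

lemma gl2_cf_step: "p \<in> Rpoly \<Longrightarrow> gl2 0 1 1 (- p)"
  unfolding gl2_def by (auto intro!: bexI[of _ "- 1"])

lemma mob_cf_step: "mob 0 1 1 (- p) x = inverse (x - p)"
  by (simp add: mob_def inverse_eq_divide)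

lemma Theta_cf_step:
  assumes "conjp \<alpha> \<alpha>'" "x \<in> Theta \<alpha>" "p \<in> Rpoly"
  shows "inverse (x - p) \<in> Theta \<alpha>" "qconj (inverse (x - p)) = inverse (qconj x - p)"
  using Theta_mob[OF assms(1,2) gl2_cf_step[OF assms(3)]]
    conjp_qconj[OF conjp_mob[OF gl2_cf_step[OF assms(3)] Theta_conjp[OF assms(1,2)]]]
  by (simp_all add: mob_cf_step)

lemma cf_rem_add: "cf_rem (cf_rem x n) m = cf_rem x (n + m)"
  by (induction m) (simp_all add: cf_rem.simps(2))

lemma cf_quot_add: "cf_quot (cf_rem x n) m = cf_quot x (n + m)"
  by (simp add: cf_quot_def cf_rem_add)

context
  fixes \<alpha> \<alpha>' :: "'a::{finite,field} fls"
  assumes conj: "conjp \<alpha> \<alpha>'"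
begin

lemma cf_rem_Theta: "cf_rem \<alpha> n \<in> Theta \<alpha>"
  by (induction n) (simp_all add: cf_rem.simps(2) Theta_self[OF conj] Theta_cf_step(1)[OF conj])

lemma cf_rem_conjp: "conjp (cf_rem \<alpha> n) (qconj (cf_rem \<alpha> n))"
  by (rule Theta_conjp[OF conj cf_rem_Theta])

lemma qconj_cf_rem_Suc: "qconj (cf_rem \<alpha> (Suc n)) = inverse (qconj (cf_rem \<alpha> n) - cf_quot \<alpha> n)"
  using Theta_cf_step(2)[OF conj cf_rem_Theta[of n] polypart_Rpoly] by (simp add: cf_quot_def cf_rem.simps(2))

lemma cf_rem_minus_quot: "cf_rem \<alpha> n - cf_quot \<alpha> n = inverse (cf_rem \<alpha> (Suc n))"
  by (simp add: cf_quot_def cf_rem.simps(2))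

lemma qconj_cf_rem_minus_quot:
  "qconj (cf_rem \<alpha> n) - cf_quot \<alpha> n = inverse (qconj (cf_rem \<alpha> (Suc n)))"
  by (simp only: qconj_cf_rem_Suc inverse_inverse_eq)

lemma cf_rem_nonzero: "cf_rem \<alpha> n \<noteq> 0" "qconj (cf_rem \<alpha> n) \<noteq> 0"
  using conjpD(1,2)[OF cf_rem_conjp[of n]] by auto

lemma absv_cf_rem_Suc: "1 < absv (cf_rem \<alpha> (Suc n))"
proof -
  have "absv (inverse (cf_rem \<alpha> (Suc n))) < 1"
    unfolding cf_rem_minus_quot[symmetric] by (simp add: cf_quot_def absv_diff_polypart)
  thus ?thesis using cf_rem_nonzero(1)[of "Suc n"] unfolding absv_inverse
    by (metis absv_pos_iff inverse_less_1_iff not_less)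
qed

lemma absv_cf_rem: "0 < n \<Longrightarrow> 1 < absv (cf_rem \<alpha> n)"
  using absv_cf_rem_Suc[of "n - 1"] by simp

lemma absv_cf_quot: "0 < n \<Longrightarrow> absv (cf_quot \<alpha> n) = absv (cf_rem \<alpha> n)"
  using absv_cong[of "cf_rem \<alpha> n" "cf_quot \<alpha> n"] absv_cf_rem[of n] absv_diff_polypart[of "cf_rem \<alpha> n"]
  by (simp add: cf_quot_def)

lemma reduced_Suc:
  assumes "0 < n" "absv (qconj (cf_rem \<alpha> n)) < 1"
  shows "absv (qconj (cf_rem \<alpha> (Suc n))) < 1"
proof -
  have "1 < absv (cf_quot \<alpha> n)" using absv_cf_quot absv_cf_rem assms by simp
  hence "1 < absv (qconj (cf_rem \<alpha> n) - cf_quot \<alpha> n)"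
    using assms absv_diff_eq[of "qconj (cf_rem \<alpha> n)" "cf_quot \<alpha> n"] by simp
  thus ?thesis unfolding qconj_cf_rem_Suc absv_inverse by (simp add: inverse_less_1_iff)
qed

lemma cf_rem_diff:
  "absv (cf_rem \<alpha> (Suc n) - qconj (cf_rem \<alpha> (Suc n))) =
   absv (cf_rem \<alpha> n - qconj (cf_rem \<alpha> n)) * absv (cf_rem \<alpha> (Suc n)) * absv (qconj (cf_rem \<alpha> (Suc n)))"
proof -
  let ?y = "cf_rem \<alpha> (Suc n)" and ?y' = "qconj (cf_rem \<alpha> (Suc n))"
  have "cf_rem \<alpha> n - qconj (cf_rem \<alpha> n) = inverse ?y - inverse ?y'"
    using cf_rem_minus_quot[of n] qconj_cf_rem_minus_quot[of n] by (simp add: algebra_simps)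
  also have "\<dots> = (?y' - ?y) / (?y * ?y')"
    using cf_rem_nonzero[of "Suc n"] by (simp add: field_simps)
  finally show ?thesis using cf_rem_nonzero[of "Suc n"]
    by (simp add: absv_divide absv_mult absv_minus_commute[of ?y' ?y])
qed

lemma qf_cf_rem:
  assumes "qf \<omega> \<omega>' \<alpha> \<alpha>'" "\<omega> + \<omega>' \<in> Rpoly"
  shows "qf \<omega> \<omega>' (cf_rem \<alpha> n) (qconj (cf_rem \<alpha> n))"
proof (induction n)
  case 0
  thus ?case using assms conjp_qconj[OF conj] by simp
next
  case (Suc n)
  note c = conjpD(1,2)[OF cf_rem_conjp[of n]]
  have g: "gl2 0 1 1 (- cf_quot \<alpha> n)" by (intro gl2_cf_step) (simp add: cf_quot_def)
  have "qf \<omega> \<omega>' (mob 0 1 1 (- cf_quot \<alpha> n) (cf_rem \<alpha> n)) (mob 0 1 1 (- cf_quot \<alpha> n) (qconj (cf_rem \<alpha> n)))"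
    by (intro qf_mob Suc assms g gl2_denom_nonzero[OF g] c)
  thus ?case unfolding mob_cf_step qconj_cf_rem_Suc by (simp add: cf_quot_def cf_rem.simps(2))
qed

text \<open>As long as the conjugates have size at least 1, \<open>cf_rem_diff\<close> makes the
  distance between quotient and conjugate grow by a factor q at each step, while the fixed
  discriminant bounds it. Once reduced, always reduced, by \<open>reduced_Suc\<close>.\<close>

lemma eventually_reduced: "\<exists>N>0. \<forall>n\<ge>N. absv (qconj (cf_rem \<alpha> n)) < 1"
proof -
  have "\<exists>N>0. absv (qconj (cf_rem \<alpha> N)) < 1"
  proof (rule ccontr)
    assume "\<not> ?thesis"
    hence ge: "1 \<le> absv (qconj (cf_rem \<alpha> (Suc n)))" for n by (meson not_less zero_less_Suc)
    define d where "d n = absv (cf_rem \<alpha> n - qconj (cf_rem \<alpha> n))" for n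
    have step: "real CARD('a) * d n \<le> d (Suc n)" for n
    proof -
      have "real CARD('a) * d n = d n * real CARD('a) * 1" by simp
      also have "\<dots> \<le> d (Suc n)" unfolding d_def cf_rem_diff[of n]
        by (intro mult_mono ge absv_gt_one absv_cf_rem_Suc order_refl) auto
      finally show ?thesis .
    qed
    have grow: "real CARD('a) ^ n * d 0 \<le> d n" for n
    proof (induction n)
      case (Suc n)
      have "real CARD('a) ^ Suc n * d 0 = real CARD('a) * (real CARD('a) ^ n * d 0)" by simp
      also have "\<dots> \<le> real CARD('a) * d n" using Suc by (intro mult_left_mono) auto
      finally show ?case using step[of n] by linarith
    qed simp
    obtain A where A: "A \<in> Rpoly" "A \<noteq> 0" "A * \<alpha> + A * \<alpha>' \<in> Rpoly" "qf (A * \<alpha>) (A * \<alpha>') \<alpha> \<alpha>'"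
      using conj by (rule qf_exists)
    define B where "B = absv (A * \<alpha> - A * \<alpha>')"
    have le: "d n \<le> B" for n
      unfolding B_def d_def by (rule qf_diff_le[OF qf_cf_rem[OF A(4,3)]])
    have d0: "0 < d 0" using conjpD(3)[OF cf_rem_conjp[of 0]] by (simp add: d_def)
    obtain n where "B / d 0 < real CARD('a) ^ n"
      using real_arch_pow[OF card_gt_one[where 'a='a]] by blast
    hence "B < d n" using grow[of n] d0 by (simp add: field_simps)
    thus False using le[of n] by simp
  qed
  then obtain N where N: "0 < N" "absv (qconj (cf_rem \<alpha> N)) < 1" by blast
  have "absv (qconj (cf_rem \<alpha> n)) < 1" if "n \<ge> N" for n
    using that by (induction n rule: dec_induct) (use N reduced_Suc in auto)
  with N(1) show ?thesis by blast
qed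

text \<open>Lagrange's argument: for a reduced quotient the leading coefficient and the shift with
  respect to one fixed \<open>\<omega>\<close> are bounded, so only finitely many quotients occur
  and two of them coincide.\<close>

lemma eventually_periodic: "\<exists>s>0. \<exists>r. \<forall>n\<ge>r. cf_quot \<alpha> (n + s) = cf_quot \<alpha> n"
proof -
  obtain N where N: "0 < N" "\<And>n. N \<le> n \<Longrightarrow> absv (qconj (cf_rem \<alpha> n)) < 1"
    using eventually_reduced by blast
  obtain A where A: "A \<in> Rpoly" "A \<noteq> 0" "A * \<alpha> + A * \<alpha>' \<in> Rpoly" "qf (A * \<alpha>) (A * \<alpha>') \<alpha> \<alpha>'"
    using conj by (rule qf_exists)
  define \<omega> \<omega>' where "\<omega> = A * \<alpha>" and "\<omega>' = A * \<alpha>'"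
  define B where "B = max (absv (\<omega> - \<omega>')) (absv \<omega>)"
  define S where "S = {f \<in> Rpoly :: 'a fls set. absv f \<le> B}"
  have "cf_rem \<alpha> n \<in> (\<lambda>(A, w). (\<omega> + w) / A) ` (S \<times> S)" if n: "N \<le> n" for n
  proof -
    obtain a w where a: "a \<in> Rpoly" "w \<in> Rpoly" "a \<noteq> 0" "a * cf_rem \<alpha> n = \<omega> + w"
        "a * qconj (cf_rem \<alpha> n) = \<omega>' + w"
      using qf_cf_rem[OF A(4,3)] unfolding \<omega>_def[symmetric] \<omega>'_def[symmetric] by (rule qfE)
    have gt: "1 < absv (cf_rem \<alpha> n)" using absv_cf_rem N n by auto
    have "absv (cf_rem \<alpha> n - qconj (cf_rem \<alpha> n)) = absv (cf_rem \<alpha> n)"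
      using N(2)[OF n] gt by (intro absv_diff_eq') auto
    moreover have "\<omega> - \<omega>' = a * (cf_rem \<alpha> n - qconj (cf_rem \<alpha> n))"
      using a by (simp add: algebra_simps)
    ultimately have d: "absv (\<omega> - \<omega>') = absv a * absv (cf_rem \<alpha> n)" by (simp add: absv_mult)
    hence "absv a \<le> absv (\<omega> - \<omega>')" using gt mult_left_mono[of 1 "absv (cf_rem \<alpha> n)" "absv a"] by simp
    moreover have "absv (\<omega> + w) = absv (\<omega> - \<omega>')" using d a(4) by (metis absv_mult)
    hence "absv w \<le> B" using absv_diff_le[of "\<omega> + w" \<omega>] by (simp add: B_def)
    ultimately have "(a, w) \<in> S \<times> S" using a by (auto simp: S_def B_def)
    moreover have "cf_rem \<alpha> n = (\<omega> + w) / a" using a by (simp add: nonzero_eq_divide_eq mult.commute)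
    ultimately show ?thesis by force
  qed
  hence "cf_rem \<alpha> ` {N..} \<subseteq> (\<lambda>(A, w). (\<omega> + w) / A) ` (S \<times> S)" by auto
  moreover have "finite S" unfolding S_def by (rule finite_Rpoly_bounded)
  ultimately have "finite (cf_rem \<alpha> ` {N..})" by (meson finite_SigmaI finite_imageI finite_subset)
  hence "\<not> inj_on (cf_rem \<alpha>) {N..}" using finite_imageD infinite_Ici by blast
  then obtain i j where ij: "i < j" "cf_rem \<alpha> i = cf_rem \<alpha> j"
    unfolding inj_on_def by (metis nat_neq_iff)
  have "cf_quot \<alpha> (n + (j - i)) = cf_quot \<alpha> n" if "i \<le> n" for n
    using cf_quot_add[of \<alpha> i "n - i"] cf_quot_add[of \<alpha> j "n - i"] ij that by (simp add: add.commute)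
  with ij(1) show ?thesis by (metis zero_less_diff)
qed

end

text \<open>With equal partial quotients the distance of the complete quotients stays below 1, yet
  grows by a factor of at least q at each step unless it is 0.\<close>

lemma cf_quot_inject:
  fixes x y :: "'a::{finite,field} fls"
  assumes x: "conjp x x'" and y: "conjp y y'" and eq: "\<And>n. cf_quot x n = cf_quot y n"
  shows "x = y"
proof (rule ccontr)
  assume "x \<noteq> y"
  define d where "d n = absv (cf_rem x n - cf_rem y n)" for n
  have d: "d n < 1" for n
    using absv_diff_less[OF absv_diff_polypart[of "cf_rem x n"] absv_diff_polypart[of "cf_rem y n"]] eq[of n]
    by (simp add: d_def cf_quot_def)
  have step: "real CARD('a) * d n \<le> d (Suc n)" for n
  proof -
    let ?u = "cf_rem x (Suc n)" and ?v = "cf_rem y (Suc n)"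
    note nz = cf_rem_nonzero(1)[OF x, of "Suc n"] cf_rem_nonzero(1)[OF y, of "Suc n"]
    have "cf_rem x n - cf_rem y n = inverse ?u - inverse ?v"
      using cf_rem_minus_quot[OF x, of n] cf_rem_minus_quot[OF y, of n] eq[of n]
      by (simp add: algebra_simps)
    also have "\<dots> = (?v - ?u) / (?u * ?v)" using nz by (simp add: field_simps)
    finally have "d (Suc n) = d n * absv ?u * absv ?v"
      using nz by (simp add: d_def absv_divide absv_mult absv_minus_commute[of ?v ?u])
    moreover have "d n * real CARD('a) * 1 \<le> d n * absv ?u * absv ?v"
      using absv_cf_rem_Suc[OF x, of n] absv_cf_rem_Suc[OF y, of n]
      by (intro mult_mono absv_gt_one) (auto simp: d_def)
    ultimately show ?thesis by (simp add: mult.commute)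
  qed
  have grow: "real CARD('a) ^ n * d 0 \<le> d n" for n
  proof (induction n)
    case (Suc n)
    have "real CARD('a) ^ Suc n * d 0 = real CARD('a) * (real CARD('a) ^ n * d 0)" by simp
    also have "\<dots> \<le> real CARD('a) * d n" using Suc by (intro mult_left_mono) auto
    finally show ?case using step[of n] by linarith
  qed simp
  have d0: "0 < d 0" using \<open>x \<noteq> y\<close> by (simp add: d_def)
  obtain n where "1 / d 0 < real CARD('a) ^ n"
    using real_arch_pow[OF card_gt_one[where 'a='a]] by blast
  hence "1 < d n" using grow[of n] d0 by (simp add: field_simps)
  thus False using d[of n] by simp
qed

lemma degY_absv: "1 \<le> absv (f::'a::{finite,field} fls) \<Longrightarrow> absv f = real CARD('a) powr real (degY f)"
proof -
  assume *: "1 \<le> absv f"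
  hence "f \<noteq> 0" by auto
  moreover from * have "fls_subdegree f \<le> 0"
    using absv_le_iff[of 1 f] \<open>f \<noteq> 0\<close> by simp
  ultimately show ?thesis by (simp add: absv_nz degY_def)
qed

lemma cf_period_facts:
  fixes \<alpha> :: "'a::{finite,field} fls"
  assumes conj: "conjp \<alpha> \<alpha>'"
  shows "0 < cf_period \<alpha>"
    and "\<And>n. cf_preperiod \<alpha> \<le> n \<Longrightarrow> cf_rem \<alpha> (n + cf_period \<alpha>) = cf_rem \<alpha> n"
    and "\<And>n. cf_preperiod \<alpha> \<le> n \<Longrightarrow> absv (cf_quot \<alpha> n) \<le> real CARD('a) powr real (cf_maxdeg \<alpha>)"
proof -
  let ?s = "cf_period \<alpha>" and ?r = "cf_preperiod \<alpha>"
  have s: "0 < ?s \<and> (\<exists>r. \<forall>n\<ge>r. cf_quot \<alpha> (n + ?s) = cf_quot \<alpha> n)"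
    unfolding cf_period_def by (rule LeastI_ex) (rule eventually_periodic[OF conj])
  thus "0 < ?s" by simp
  from s obtain r where "\<forall>n\<ge>r. cf_quot \<alpha> (n + ?s) = cf_quot \<alpha> n" by blast
  \<comment> \<open>\<open>Suc r\<close> because the preperiod is required to be positive.\<close>
  hence "0 < Suc r \<and> (\<forall>n\<ge>Suc r. cf_quot \<alpha> (n + ?s) = cf_quot \<alpha> n)" by simp
  hence r: "0 < ?r \<and> (\<forall>n\<ge>?r. cf_quot \<alpha> (n + ?s) = cf_quot \<alpha> n)"
    unfolding cf_preperiod_def by (rule LeastI)
  show "cf_rem \<alpha> (n + ?s) = cf_rem \<alpha> n" if n: "?r \<le> n" for n
  proof (rule cf_quot_inject[OF cf_rem_conjp[OF conj] cf_rem_conjp[OF conj]])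
    fix k
    have "cf_quot \<alpha> (n + k + ?s) = cf_quot \<alpha> (n + k)" using r n by simp
    thus "cf_quot (cf_rem \<alpha> (n + ?s)) k = cf_quot (cf_rem \<alpha> n) k"
      by (simp add: cf_quot_add ac_simps)
  qed
  show "absv (cf_quot \<alpha> n) \<le> real CARD('a) powr real (cf_maxdeg \<alpha>)" if n: "?r \<le> n" for n
  proof -
    let ?D = "{degY (cf_quot \<alpha> n) | n. ?r \<le> n \<and> n < ?r + ?s}"
    \<comment> \<open>Reduction modulo the period, so that the maximum over one period bounds all
      later degrees.\<close>
    have per: "cf_quot \<alpha> (?r + k) = cf_quot \<alpha> (?r + k mod ?s)" for k
    proof (induction k rule: less_induct)
      case (less k)
      show ?case
      proof (cases "k < ?s")
        case False
        hence "cf_quot \<alpha> (?r + k) = cf_quot \<alpha> (?r + (k - ?s) + ?s)" by simp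
        also have "\<dots> = cf_quot \<alpha> (?r + (k - ?s))" using r by simp
        also have "\<dots> = cf_quot \<alpha> (?r + (k - ?s) mod ?s)" using False s by (intro less) auto
        finally show ?thesis using False by (simp add: le_mod_geq)
      qed simp
    qed
    have eq: "cf_quot \<alpha> n = cf_quot \<alpha> (?r + (n - ?r) mod ?s)" using per[of "n - ?r"] n by simp
    have "degY (cf_quot \<alpha> n) \<le> Max ?D"
      by (rule Max_ge) (use s in \<open>auto simp: eq intro!: exI[of _ "?r + (n - ?r) mod ?s"]\<close>)
    hence "degY (cf_quot \<alpha> n) \<le> cf_maxdeg \<alpha>" by (simp add: cf_maxdeg_def)
    moreover have "1 \<le> absv (cf_quot \<alpha> n)"
      using absv_cf_quot[OF conj, of n] absv_cf_rem[OF conj, of n] r n by simp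
    ultimately show ?thesis unfolding degY_absv[OF \<open>1 \<le> absv (cf_quot \<alpha> n)\<close>] by simp
  qed
qed

section \<open>Bi-infinite periodic expansions\<close>

text \<open>\<open>x n\<close> and \<open>x' n\<close> stand for the inverses of the complete
  quotient at place n and of its conjugate; D stands for q^d. Integer indices allow steps in both
  directions along the axis.\<close>

locale biperiodic =
  fixes b x x' :: "int \<Rightarrow> 'a::{finite,field} fls" and s :: nat and D :: real
  assumes b_Rpoly: "b n \<in> Rpoly"
    and x_step: "x n * (b n + x (n + 1)) = 1"
    and x'_step: "x' n * (b n + x' (n + 1)) = 1"
    and x_less: "absv (x n) < 1"
    and x'_gt: "1 < absv (x' n)"
    and b_le: "absv (b n) \<le> D"
    and x_period: "x (n + int s) = x n"
    and x'_period: "x' (n + int s) = x' n"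
    and s_pos: "0 < s"
    and conjp_x: "conjp (x n) (x' n)"
begin

lemma absv_b_x: "absv (x n) * absv (b n) = 1"
proof -
  have inv: "absv (b n + x (n + 1)) = inverse (absv (x n))"
    using inverse_unique[OF x_step[of n]] by (simp flip: absv_inverse)
  have "x n \<noteq> 0" using x_step[of n] by auto
  hence "1 < absv (b n + x (n + 1))"
    unfolding inv using x_less[of n] by (intro one_less_inverse) auto
  hence "absv (b n) = absv (b n + x (n + 1))"
    using x_less[of "n + 1"] absv_diff_eq'[of "x (n + 1)" "b n + x (n + 1)"] by simp
  with inv \<open>x n \<noteq> 0\<close> show ?thesis by simp
qed

lemma x_nonzero: "x n \<noteq> 0" "x' n \<noteq> 0"
  using x_step[of n] x'_step[of n] by auto

lemma b_gt: "1 < absv (b n)"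
proof -
  have "absv (b n) \<noteq> 0" using absv_b_x[of n] by auto
  hence "absv (x n) * absv (b n) < 1 * absv (b n)" using x_less by (intro mult_strict_right_mono) auto
  thus ?thesis using absv_b_x[of n] by simp
qed

text \<open>The conjugate reads the expansion backwards: \<open>x' (n + 1)\<close> is minus the
  previous letter up to an error smaller than 1.\<close>

lemma absv_x'_Suc: "absv (x' (n + 1)) = absv (b n)"
proof -
  have "absv (b n + x' (n + 1)) = inverse (absv (x' n))"
    using inverse_unique[OF x'_step[of n]] by (simp flip: absv_inverse)
  hence "absv (b n + x' (n + 1)) < 1" using x'_gt[of n] by (simp add: inverse_less_1_iff)
  hence "absv (b n - (- x' (n + 1))) < absv (b n)" using b_gt[of n] by simp
  thus ?thesis using absv_cong[of "b n" "- x' (n + 1)"] by simp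
qed

lemma absv_x_x'_Suc: "absv (x n) * absv (x' (n + 1)) = 1"
  by (simp add: absv_x'_Suc absv_b_x)

lemma x'_le: "absv (x' n) \<le> D"
  using absv_x'_Suc[of "n - 1"] b_le[of "n - 1"] by simp

lemma D_gt_one: "1 < D"
  using b_gt[of 0] b_le[of 0] by simp

lemma D_ge_one: "1 \<le> D"
  using D_gt_one by simp

lemma absv_x_diff: "absv (x n - x' n) = absv (x' n)"
  using x_less[of n] x'_gt[of n] by (intro absv_diff_eq) simp

subsection \<open>The norm form\<close>

text \<open>The linear form \<open>u + v x\<^sub>n\<close> grows along the expansion while its conjugate \<open>u + v x'\<^sub>n\<close> decays; the product
  is controlled at the index where their order switches.\<close>

lemma form_step:
  "u + v * x n = x n * ((u * b n + v) + u * x (n + 1))"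
  "u + v * x' n = x' n * ((u * b n + v) + u * x' (n + 1))"
proof -
  have "u + v * x n = u * (x n * (b n + x (n + 1))) + v * x n" by (simp add: x_step)
  thus "u + v * x n = x n * ((u * b n + v) + u * x (n + 1))" by (simp add: algebra_simps)
  have "u + v * x' n = u * (x' n * (b n + x' (n + 1))) + v * x' n" by (simp add: x'_step)
  thus "u + v * x' n = x' n * ((u * b n + v) + u * x' (n + 1))" by (simp add: algebra_simps)
qed

lemma form_nonzero:
  assumes "u \<in> Rpoly" "v \<in> Rpoly" "u \<noteq> 0 \<or> v \<noteq> 0"
  shows "u + v * x n \<noteq> 0" "u + v * x' n \<noteq> 0"
  using linear_nonzero[of _ v u] conjpD(1,2)[OF conjp_x[of n]] assms by auto

lemma x'_le_forms:
  assumes "v \<in> Rpoly" "v \<noteq> 0"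
  shows "absv (x' n) \<le> max (absv (u + v * x n)) (absv (u + v * x' n))"
proof -
  have "absv (x' n) = 1 * absv (x n - x' n)" by (simp add: absv_x_diff)
  also have "\<dots> \<le> absv v * absv (x n - x' n)" by (intro mult_right_mono absv_Rpoly_ge_one assms) auto
  also have "\<dots> = absv ((u + v * x n) - (u + v * x' n))" by (simp add: absv_mult[symmetric] algebra_simps)
  also have "\<dots> \<le> max (absv (u + v * x n)) (absv (u + v * x' n))" by (rule absv_diff_le)
  finally show ?thesis .
qed

text \<open>Each step divides the form by something small and its conjugate by something large, so
  the gap of subdegrees shrinks; the claimed inequality is carried back by
  \<open>absv_x_x'_Suc\<close>.\<close>

lemma norm_bound_forward:
  assumes "u \<in> Rpoly" "v \<in> Rpoly" "u \<noteq> 0 \<or> v \<noteq> 0" "absv (u + v * x n) \<le> absv (u + v * x' n)"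
  shows "absv (x' n) \<le> D * (absv (u + v * x n) * absv (u + v * x' n))"
  using assms
proof (induction "nat (fls_subdegree (u + v * x n) - fls_subdegree (u + v * x' n))"
    arbitrary: u v n rule: less_induct)
  case less
  note nz = form_nonzero[OF less.prems(1-3), of n]
  define u1 where "u1 = u * b n + v"
  have R: "u1 \<in> Rpoly" using less.prems b_Rpoly[of n] by (auto simp: u1_def)
  have ne: "u1 \<noteq> 0 \<or> u \<noteq> 0" using less.prems by (auto simp: u1_def)
  note nz1 = form_nonzero[OF R less.prems(1) ne, of "n + 1"]
  note st = form_step[of u v n, folded u1_def]
  show ?case
  proof (cases "absv (u1 + u * x (n + 1)) \<le> absv (u1 + u * x' (n + 1))")
    case True
    have "fls_subdegree (u + v * x n) = fls_subdegree (x n) + fls_subdegree (u1 + u * x (n + 1))"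
      unfolding st using x_nonzero nz1 by (intro fls_subdegree_mult) auto
    moreover have "fls_subdegree (u + v * x' n) = fls_subdegree (x' n) + fls_subdegree (u1 + u * x' (n + 1))"
      unfolding st using x_nonzero nz1 by (intro fls_subdegree_mult) auto
    moreover have "fls_subdegree (x n) > 0" using x_less[of n] x_nonzero[of n] absv_less_iff[of "x n" 1] by simp
    moreover have "fls_subdegree (x' n) < 0" using x'_gt[of n] x_nonzero[of n] absv_less_iff[of 1 "x' n"] by simp
    moreover have "fls_subdegree (u1 + u * x' (n + 1)) \<le> fls_subdegree (u1 + u * x (n + 1))"
      using True absv_le_iff[OF nz1] by simp
    ultimately have "absv (x' (n + 1)) \<le> D * (absv (u1 + u * x (n + 1)) * absv (u1 + u * x' (n + 1)))"
      using True by (intro less.hyps R less.prems ne) auto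
    hence "absv (x n) * absv (x' n) * absv (x' (n + 1)) \<le>
        absv (x n) * absv (x' n) * (D * (absv (u1 + u * x (n + 1)) * absv (u1 + u * x' (n + 1))))"
      by (intro mult_left_mono) auto
    also have "\<dots> = D * (absv (u + v * x n) * absv (u + v * x' n))"
      unfolding st by (simp add: absv_mult)
    also have "absv (x n) * absv (x' n) * absv (x' (n + 1)) = absv (x' n)"
      using absv_x_x'_Suc[of n] by (simp add: mult.commute mult.left_commute)
    finally show ?thesis .
  next
    case False
    \<comment> \<open>The order switches between n and n + 1: the larger form there has size at
      least |x'(n+1)|, hence the form at n has size at least 1.\<close>
    hence "u \<noteq> 0" by auto
    hence "absv (x' (n + 1)) \<le> absv (u1 + u * x (n + 1))"
      using x'_le_forms[OF less.prems(1), of "n + 1" u1] False by simp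
    hence "absv (x n) * absv (x' (n + 1)) \<le> absv (x n) * absv (u1 + u * x (n + 1))"
      by (intro mult_left_mono) auto
    hence one: "1 \<le> absv (u + v * x n)" unfolding st by (simp add: absv_mult absv_x_x'_Suc)
    show ?thesis
    proof (cases "v = 0")
      case True
      \<comment> \<open>This case accounts for the factor D: both forms are the constant u, while
        |x' n| may be as large as D.\<close>
      have "D * (1 * 1) \<le> D * (absv (u + v * x n) * absv (u + v * x' n))"
        using one less.prems(4) D_ge_one by (intro mult_left_mono mult_mono) auto
      thus ?thesis using x'_le[of n] by simp
    next
      case False
      hence "absv (x' n) \<le> absv (u + v * x' n)"
        using x'_le_forms[OF less.prems(2), of n u] less.prems(4) by simp
      hence "1 * (1 * absv (x' n)) \<le> D * (absv (u + v * x n) * absv (u + v * x' n))"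
        using one D_ge_one by (intro mult_mono) auto
      thus ?thesis by simp
    qed
  qed
qed

text \<open>The same descent in the opposite direction, until the order switches and the forward
  bound applies.\<close>

lemma norm_bound_backward:
  assumes "u \<in> Rpoly" "v \<in> Rpoly" "u \<noteq> 0 \<or> v \<noteq> 0" "absv (u + v * x' n) < absv (u + v * x n)"
  shows "absv (x' n) \<le> D * (absv (u + v * x n) * absv (u + v * x' n))"
  using assms
proof (induction "nat (fls_subdegree (u + v * x' n) - fls_subdegree (u + v * x n))"
    arbitrary: u v n rule: less_induct)
  case less
  note nz = form_nonzero[OF less.prems(1-3), of n]
  \<comment> \<open>Chosen so that \<open>form_step\<close> at n - 1 maps the coefficients (v, v0)
    to (u, v).\<close>
  define v0 where "v0 = u - v * b (n - 1)"
  have R: "v0 \<in> Rpoly" using less.prems b_Rpoly by (auto simp: v0_def)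
  have ne: "v \<noteq> 0 \<or> v0 \<noteq> 0" using less.prems by (auto simp: v0_def)
  note nz0 = form_nonzero[OF less.prems(2) R ne, of "n - 1"]
  have st: "v + v0 * x (n - 1) = x (n - 1) * (u + v * x n)"
           "v + v0 * x' (n - 1) = x' (n - 1) * (u + v * x' n)"
    using form_step[of v v0 "n - 1"] by (simp_all add: v0_def)
  have "absv (x' (n - 1)) \<le> D * (absv (v + v0 * x (n - 1)) * absv (v + v0 * x' (n - 1)))"
  proof (cases "absv (v + v0 * x (n - 1)) \<le> absv (v + v0 * x' (n - 1))")
    case True
    thus ?thesis by (intro norm_bound_forward less.prems R ne)
  next
    case False
    have "fls_subdegree (v + v0 * x (n - 1)) = fls_subdegree (x (n - 1)) + fls_subdegree (u + v * x n)"
      unfolding st using x_nonzero nz by (intro fls_subdegree_mult) auto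
    moreover have "fls_subdegree (v + v0 * x' (n - 1)) = fls_subdegree (x' (n - 1)) + fls_subdegree (u + v * x' n)"
      unfolding st using x_nonzero nz by (intro fls_subdegree_mult) auto
    moreover have "fls_subdegree (x (n - 1)) > 0"
      using x_less[of "n - 1"] x_nonzero[of "n - 1"] absv_less_iff[of "x (n - 1)" 1] by simp
    moreover have "fls_subdegree (x' (n - 1)) < 0"
      using x'_gt[of "n - 1"] x_nonzero[of "n - 1"] absv_less_iff[of 1 "x' (n - 1)"] by simp
    moreover have "fls_subdegree (u + v * x n) < fls_subdegree (u + v * x' n)"
      using less.prems(4) absv_less_iff[OF nz(2,1)] by simp
    ultimately show ?thesis
      using False by (intro less.hyps R less.prems ne) auto
  qed
  hence "absv (x' n) * absv (x' (n - 1)) \<le>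
      absv (x' n) * (D * (absv (v + v0 * x (n - 1)) * absv (v + v0 * x' (n - 1))))"
    by (intro mult_left_mono) auto
  also have "\<dots> = (absv (x (n - 1)) * absv (x' n)) * (D * (absv (u + v * x n) * absv (u + v * x' n))) * absv (x' (n - 1))"
    unfolding st by (simp add: absv_mult)
  also have "absv (x (n - 1)) * absv (x' n) = 1" using absv_x_x'_Suc[of "n - 1"] by simp
  finally show ?case using x_nonzero[of "n - 1"] by simp
qed

lemma norm_bound:
  assumes "u \<in> Rpoly" "v \<in> Rpoly" "u \<noteq> 0 \<or> v \<noteq> 0"
  shows "absv (x n - x' n) \<le> D * (absv (u + v * x n) * absv (u + v * x' n))"
  unfolding absv_x_diff using norm_bound_forward[OF assms] norm_bound_backward[OF assms] by force

text \<open>A homography divides the distance of the endpoints by the norm of c x + e, so the norm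
  bound says that no axis of the orbit climbs above D.\<close>

lemma mob_diff_le:
  assumes g: "gl2 p q c e"
  shows "absv (mob p q c e (x n) - mob p q c e (x' n)) \<le> D"
proof -
  note nz = gl2_denom_nonzero[OF g conjpD(1)[OF conjp_x[of n]]] gl2_denom_nonzero[OF g conjpD(2)[OF conjp_x[of n]]]
  obtain u where u: "u \<in> Rpoly" "(p * e - q * c) * u = 1" and R: "p \<in> Rpoly" "q \<in> Rpoly" "c \<in> Rpoly" "e \<in> Rpoly"
    using g by (auto simp: gl2_def)
  have "absv (p * e - q * c) = 1" by (rule absv_Rpoly_unit[OF _ u]) (intro Rpoly_diff Rpoly_mult R)
  hence "absv (mob p q c e (x n) - mob p q c e (x' n)) =
      absv (x n - x' n) / (absv (e + c * x n) * absv (e + c * x' n))"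
    unfolding mob_diff[OF nz] by (simp add: absv_mult absv_divide add.commute)
  also have "e \<noteq> 0 \<or> c \<noteq> 0" using u by auto
  hence "absv (x n - x' n) / (absv (e + c * x n) * absv (e + c * x' n)) \<le> D"
    using norm_bound[OF R(4,3)] form_nonzero[OF R(4,3)] by (simp add: divide_le_eq)
  finally show ?thesis .
qed

lemma Theta_diff_le:
  assumes "\<beta> \<in> Theta (x 0)"
  shows "absv (\<beta> - qconj \<beta>) \<le> D"
  using assms
proof (rule ThetaE[OF conjp_x[of 0]])
  fix p q c e assume g: "gl2 p q c e" "\<beta> = mob p q c e (x 0)" "qconj \<beta> = mob p q c e (x' 0)"
  thus ?thesis using mob_diff_le[OF g(1), of 0] by simp
next
  fix p q c e assume g: "gl2 p q c e" "\<beta> = mob p q c e (x' 0)" "qconj \<beta> = mob p q c e (x 0)"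
  thus ?thesis using mob_diff_le[OF g(1), of 0] by (simp add: absv_minus_commute)
qed

section \<open>The unit attached to one period and the discriminant\<close>

lemma form_iterate:
  assumes "u \<in> Rpoly" "v \<in> Rpoly"
  shows "\<exists>u1\<in>Rpoly. \<exists>v1\<in>Rpoly. u + v * x 0 = (\<Prod>i<k. x (int i)) * (u1 + v1 * x (int k)) \<and>
    u + v * x' 0 = (\<Prod>i<k. x' (int i)) * (u1 + v1 * x' (int k))"
proof (induction k)
  case 0
  show ?case using assms by (intro bexI[of _ u] bexI[of _ v]) auto
next
  case (Suc k)
  then obtain u1 v1 where 1: "u1 \<in> Rpoly" "v1 \<in> Rpoly"
    "u + v * x 0 = (\<Prod>i<k. x (int i)) * (u1 + v1 * x (int k))"
    "u + v * x' 0 = (\<Prod>i<k. x' (int i)) * (u1 + v1 * x' (int k))"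
    by blast
  have k: "int k + 1 = int (Suc k)" by simp
  have "u1 * b (int k) + v1 \<in> Rpoly" using 1 b_Rpoly by (intro Rpoly_add Rpoly_mult)
  with 1 show ?case
    by (intro bexI[of _ "u1 * b (int k) + v1"] bexI[of _ u1])
      (simp_all only: form_step[of u1 v1 "int k"] k prod.lessThan_Suc mult.assoc simp_thms)
qed

text \<open>After one period the basis (1, x 0) is multiplied by the unit \<open>\<epsilon>\<close>,
  so 1/\<open>\<epsilon>\<close> = Q + Q' x 0. Then Q' (x 0 - x' 0) is the difference of
  1/\<open>\<epsilon>\<close>, whose size is the product of the letters, and its conjugate, of size
  at most 1.\<close>

lemma discriminant_root_le:
  obtains \<omega> \<omega>' where "qf \<omega> \<omega>' (x 0) (x' 0)" "\<omega> + \<omega>' \<in> Rpoly" "absv (\<omega> - \<omega>') \<le> D ^ s"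
proof -
  define \<epsilon> \<epsilon>' where "\<epsilon> = (\<Prod>i<s. x (int i))" and "\<epsilon>' = (\<Prod>i<s. x' (int i))"
  have ps: "x (int s) = x 0" "x' (int s) = x' 0" using x_period[of 0] x'_period[of 0] by auto
  obtain Q Q' where Q: "Q \<in> Rpoly" "Q' \<in> Rpoly" "1 = \<epsilon> * (Q + Q' * x 0)" "1 = \<epsilon>' * (Q + Q' * x' 0)"
    using form_iterate[of 1 0 s] by (auto simp: \<epsilon>_def \<epsilon>'_def ps)
  obtain P P' where P: "P \<in> Rpoly" "P' \<in> Rpoly" "x 0 = \<epsilon> * (P + P' * x 0)" "x' 0 = \<epsilon>' * (P + P' * x' 0)"
    using form_iterate[of 0 1 s] by (auto simp: \<epsilon>_def \<epsilon>'_def ps)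
  have nz: "\<epsilon> \<noteq> 0" "\<epsilon>' \<noteq> 0" using Q by auto
  have prod: "absv (prod f {..<k}) = (\<Prod>i<k. absv (f i))" for f :: "nat \<Rightarrow> 'a fls" and k
    by (induction k) (simp_all add: absv_mult)
  have le': "1 \<le> absv \<epsilon>'" unfolding \<epsilon>'_def prod using x'_gt by (intro prod_ge_1) (simp add: less_imp_le)
  have "absv \<epsilon> * (\<Prod>i<s. absv (b (int i))) = 1"
    unfolding \<epsilon>_def prod prod.distrib[symmetric] by (simp add: absv_b_x)
  hence "absv (inverse \<epsilon>) = (\<Prod>i<s. absv (b (int i)))"
    unfolding absv_inverse by (rule inverse_unique)
  also have "\<dots> \<le> (\<Prod>i<s. D)" by (intro prod_mono) (simp add: b_le)
  finally have e: "absv (inverse \<epsilon>) \<le> D ^ s" by simp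
  have gt: "1 < absv (inverse \<epsilon>)"
  proof -
    have "1 < (\<Prod>i<s. absv (b (int i)))"
      using s_pos by (induction s rule: nat_induct_non_zero) (auto simp: b_gt intro: less_1_mult)
    thus ?thesis using \<open>absv (inverse \<epsilon>) = _\<close> by simp
  qed
  have e': "absv (inverse \<epsilon>') \<le> 1" unfolding absv_inverse using le' by (intro inverse_le_1_iff[THEN iffD2]) simp
  have iQ: "inverse \<epsilon> = Q + Q' * x 0" "inverse \<epsilon>' = Q + Q' * x' 0"
    using Q(3,4) by (metis inverse_unique)+
  \<comment> \<open>Otherwise both inverses would equal Q, although one is larger than 1 and the
    other is not.\<close>
  have "Q' \<noteq> 0" using iQ gt e' by auto
  have rel: "x 0 * (Q + Q' * x 0) = P + P' * x 0" "x' 0 * (Q + Q' * x' 0) = P + P' * x' 0"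
  proof -
    have "x 0 * inverse \<epsilon> = P + P' * x 0" using P(3) nz by (simp add: field_simps)
    thus "x 0 * (Q + Q' * x 0) = P + P' * x 0" by (simp only: iQ)
    have "x' 0 * inverse \<epsilon>' = P + P' * x' 0" using P(4) nz by (simp add: field_simps)
    thus "x' 0 * (Q + Q' * x' 0) = P + P' * x' 0" by (simp only: iQ)
  qed
  have "x 0 - x' 0 \<noteq> 0" using conjpD(3)[OF conjp_x] by simp
  \<comment> \<open>Subtracting the conjugate equations and cancelling x 0 - x' 0 yields the trace,
    in every characteristic.\<close>
  moreover have "(x 0 - x' 0) * (Q' * x 0 + Q' * x' 0 - (P' - Q)) =
      (x 0 * (Q + Q' * x 0) - (P + P' * x 0)) - (x' 0 * (Q + Q' * x' 0) - (P + P' * x' 0))"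
    by (simp add: algebra_simps)
  ultimately have tr: "Q' * x 0 + Q' * x' 0 = P' - Q" using rel by simp
  have "Q' * x 0 * x' 0 = x 0 * (Q' * x 0 + Q' * x' 0) - Q' * x 0 * x 0" by (simp add: algebra_simps)
  also have "\<dots> = - P - (x 0 * (Q + Q' * x 0) - (P + P' * x 0))" unfolding tr by (simp add: algebra_simps)
  also have "\<dots> = - P" using rel by simp
  finally have nm: "Q' * x 0 * x' 0 \<in> Rpoly" using P by auto
  have qf: "qf (Q' * x 0) (Q' * x' 0) (x 0) (x' 0)"
    unfolding qf_def using nm Q \<open>Q' \<noteq> 0\<close> by (intro bexI[of _ Q'] bexI[of _ 0]) auto
  moreover have "Q' * x 0 + Q' * x' 0 \<in> Rpoly" unfolding tr using P Q by auto
  moreover have "absv (Q' * x 0 - Q' * x' 0) \<le> D ^ s"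
  proof -
    have "Q' * x 0 - Q' * x' 0 = inverse \<epsilon> - inverse \<epsilon>'" by (simp add: iQ)
    moreover have "1 \<le> D ^ s" using D_ge_one by simp
    ultimately show ?thesis using absv_diff_le[of "inverse \<epsilon>" "inverse \<epsilon>'"] e e' by simp
  qed
  ultimately show thesis by (rule that)
qed

end

section \<open>Finite continued fractions\<close>

text \<open>The value [0; a_1, ..., a_n + y] as a function of the tail y.\<close>

primrec cfw :: "'a::field fls list \<Rightarrow> 'a fls \<Rightarrow> 'a fls" where
  "cfw [] y = y"
| "cfw (a # w) y = inverse (a + cfw w y)"

text \<open>For nonconstant letters this is the size of the continuant, the denominator of the
  convergent; hence its square is the contraction factor in \<open>cfw_diff\<close>.\<close>

definition cfnorm :: "'a::{finite,field} fls list \<Rightarrow> real" where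
  "cfnorm w = prod_list (map absv w)"

definition cfword :: "'a::{finite,field} fls list \<Rightarrow> bool" where
  "cfword w \<longleftrightarrow> (\<forall>a\<in>set w. a \<in> Rpoly \<and> 1 < absv a)"

lemma cfw_append: "cfw (v @ w) y = cfw v (cfw w y)"
  by (induction v) simp_all

lemma cfnorm_simps [simp]: "cfnorm [] = 1" "cfnorm (a # w) = absv a * cfnorm w" "cfnorm (v @ w) = cfnorm v * cfnorm w"
  by (simp_all add: cfnorm_def)

lemma cfword_simps [simp]: "cfword []" "cfword (a # w) \<longleftrightarrow> a \<in> Rpoly \<and> 1 < absv a \<and> cfword w"
  "cfword (v @ w) \<longleftrightarrow> cfword v \<and> cfword w"
  by (auto simp: cfword_def)

lemma cfnorm_ge_one: "cfword w \<Longrightarrow> 1 \<le> cfnorm w"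
proof (induction w)
  case (Cons a w)
  hence "1 * 1 \<le> absv a * cfnorm w" by (intro mult_mono) auto
  thus ?case by simp
qed simp

lemma absv_add_small: "1 < absv a \<Longrightarrow> absv y < 1 \<Longrightarrow> absv (a + y) = absv a"
  by (intro absv_add_eq') simp

lemma cfw_less_one:
  assumes "cfword w" "absv y < 1" shows "absv (cfw w y) < 1"
  using assms by (induction w) (simp_all add: absv_inverse absv_add_small inverse_less_1_iff)

lemma inverse_add_diff:
  fixes a y z :: "'a::{finite,field} fls"
  assumes "1 < absv a" "absv y < 1" "absv z < 1"
  shows "absv (inverse (a + y) - inverse (a + z)) * absv a ^ 2 = absv (y - z)"
proof -
  have "absv (a + y) = absv a" "absv (a + z) = absv a" using assms by (simp_all add: absv_add_small)
  moreover have "a + y \<noteq> 0" "a + z \<noteq> 0" "a \<noteq> 0" using calculation assms(1) by fastforce+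
  moreover have "inverse (a + y) - inverse (a + z) = (z - y) / ((a + y) * (a + z))"
    using calculation by (simp add: field_simps)
  ultimately show ?thesis
    by (simp add: absv_divide absv_mult absv_minus_commute[of z y] power2_eq_square)
qed

lemma cfw_diff:
  assumes "cfword w" "absv y < 1" "absv z < 1"
  shows "absv (cfw w y - cfw w z) * cfnorm w ^ 2 = absv (y - z)"
  using assms(1)
proof (induction w)
  case (Cons a w)
  have "absv (cfw (a # w) y - cfw (a # w) z) * cfnorm (a # w) ^ 2 =
      (absv (inverse (a + cfw w y) - inverse (a + cfw w z)) * absv a ^ 2) * cfnorm w ^ 2"
    by (simp add: power_mult_distrib)
  also have "absv (inverse (a + cfw w y) - inverse (a + cfw w z)) * absv a ^ 2 = absv (cfw w y - cfw w z)"
    using Cons.prems assms(2,3) by (intro inverse_add_diff cfw_less_one) auto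
  finally show ?case using Cons by simp
qed simp

text \<open>While m > 2e the word copies the letter b n and m drops by 2e; the last letter is
  altered or omitted so that the distance is exactly q^-m. The bound on \<open>cfnorm\<close> later
  limits how far an axis can follow one copy of w.\<close>

lemma (in biperiodic) approximating_word:
  assumes "1 \<le> m"
  shows "\<exists>w. cfword w \<and> cfnorm w ^ 2 \<le> D * real CARD('a) ^ m \<and>
    (\<forall>y. absv y < 1 / D \<longrightarrow> absv (cfw w y - x n) * real CARD('a) ^ m = 1)"
  using assms
proof (induction m arbitrary: n rule: less_induct)
  case (less m)
  let ?q = "real CARD('a)"
  note q = card_gt_one[where 'a='a]
  define e where "e = degY (b n)"
  have b: "absv (b n) = ?q ^ e"
    using degY_absv[of "b n"] b_gt[of n] q by (simp add: e_def powr_realpow)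
  hence e: "1 \<le> e" using b_gt[of n] by (cases e) auto
  have bx: "absv (x n) * ?q ^ e = 1" using absv_b_x[of n] by (simp add: b)
  have xinv: "x n = inverse (b n + x (n + 1))"
    using x_step[of n] by (metis inverse_unique mult.commute)
  have eD: "?q ^ e \<le> D" using b_le[of n] by (simp add: b)
  have small: "absv y < 1" if "absv y < 1 / D" for y :: "'a fls"
    using that D_ge_one by (smt (verit) divide_le_eq_1)
  have Xpow: "absv (fls_X_inv ^ k :: 'a fls) = ?q ^ k" for k
    using q by (simp add: absv_X_inv_power powr_realpow)
  consider "m = e" | "m < e" | "e < m" "m \<le> 2 * e" | "2 * e < m" by linarith
  thus ?case
  proof cases
    case 1
    \<comment> \<open>The empty word suffices, since the tail is smaller than 1/D and hence than x
      n.\<close>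
    have "absv (y - x n) * ?q ^ m = 1" if y: "absv y < 1 / D" for y
    proof -
      have "1 / D \<le> absv (x n)"
        using mult_left_mono[OF eD, of "absv (x n)"] D_ge_one bx by (simp add: divide_le_eq)
      hence "absv (y - x n) = absv (x n)" using y by (intro absv_diff_eq) simp
      thus ?thesis using bx 1 by simp
    qed
    moreover have "1 * 1 \<le> D * ?q ^ m" using D_ge_one q by (intro mult_mono) auto
    ultimately show ?thesis by (intro exI[of _ "[]"]) auto
  next
    case 2
    \<comment> \<open>A letter of degree m < e gives an inverse of size q^-m, which dominates x
      n.\<close>
    define c where "c = (fls_X_inv ^ m :: 'a fls)"
    have c: "c \<in> Rpoly" "absv c = ?q ^ m" by (simp_all add: c_def Xpow)
    have c1: "1 < absv c" using less.prems q by (simp add: c one_less_power)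
    have "absv (inverse (c + y) - x n) * ?q ^ m = 1" if y: "absv y < 1 / D" for y
    proof -
      have v: "absv (inverse (c + y)) = inverse (?q ^ m)"
        using absv_add_small[OF c1 small[OF y]] by (simp add: absv_inverse c)
      have "?q ^ m < ?q ^ e" using 2 q by simp
      hence "inverse (?q ^ e) < inverse (?q ^ m)" using q by (intro less_imp_inverse_less) auto
      moreover have "absv (x n) = inverse (?q ^ e)" using bx by (metis inverse_unique mult.commute)
      ultimately have "absv (inverse (c + y) - x n) = inverse (?q ^ m)"
        using absv_diff_eq'[of "x n" "inverse (c + y)"] v by simp
      thus ?thesis using q by simp
    qed
    moreover have "(?q ^ m) ^ 2 \<le> D * ?q ^ m"
    proof -
      have "?q ^ m \<le> ?q ^ e" using 2 q by (intro power_increasing) auto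
      hence "?q ^ m * ?q ^ m \<le> D * ?q ^ m" using eD by (intro mult_right_mono) auto
      thus ?thesis by (simp add: power2_eq_square)
    qed
    ultimately show ?thesis using c c1 by (intro exI[of _ "[c]"]) auto
  next
    case 3
    \<comment> \<open>Perturbing the letter by Y^(2e-m) moves its inverse by q^(2e-m) / q^(2e) =
      q^-m; the tails contribute less because |X| is at least 1.\<close>
    define X where "X = (fls_X_inv ^ (2 * e - m) :: 'a fls)"
    have X: "X \<in> Rpoly" "absv X = ?q ^ (2 * e - m)" by (simp_all add: X_def Xpow)
    define c where "c = b n + X"
    have "absv X < absv (b n)" using 3 q by (simp add: X b)
    hence c: "absv c = ?q ^ e" "c \<in> Rpoly" using X b_Rpoly[of n] by (auto simp: c_def absv_add_eq' b)
    have c1: "1 < absv c" using e q by (simp add: c one_less_power)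
    have "absv (inverse (c + y) - x n) * ?q ^ m = 1" if y: "absv y < 1 / D" for y
    proof -
      have a: "absv (c + y) = ?q ^ e" "absv (b n + x (n + 1)) = ?q ^ e"
        using absv_add_small[OF c1 small[OF y]] absv_add_small[OF b_gt x_less] by (simp_all add: c b)
      hence nz: "c + y \<noteq> 0" "b n + x (n + 1) \<noteq> 0" using q by auto
      have "inverse (c + y) - x n = ((x (n + 1) - y) - X) / ((c + y) * (b n + x (n + 1)))"
        unfolding xinv using nz by (simp add: field_simps c_def)
      moreover have "absv ((x (n + 1) - y) - X) = ?q ^ (2 * e - m)"
      proof -
        have "absv (x (n + 1) - y) < 1" by (intro absv_diff_less x_less small y)
        also have "1 \<le> absv X" using q by (simp add: X)
        finally show ?thesis by (simp add: absv_diff_eq X)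
      qed
      ultimately have "absv (inverse (c + y) - x n) = ?q ^ (2 * e - m) / (?q ^ e * ?q ^ e)"
        by (simp add: absv_divide absv_mult a)
      moreover have "?q ^ (2 * e - m) * ?q ^ m = ?q ^ e * ?q ^ e"
        using 3 by (simp add: power_add[symmetric] mult_2)
      ultimately show ?thesis using q by simp
    qed
    moreover have "(?q ^ e) ^ 2 \<le> D * ?q ^ m"
    proof -
      have "?q ^ e \<le> ?q ^ m" using 3 q by (intro power_increasing) auto
      hence "?q ^ e * ?q ^ e \<le> D * ?q ^ m" using eD D_ge_one by (intro mult_mono) auto
      thus ?thesis by (simp add: power2_eq_square)
    qed
    ultimately show ?thesis using c c1 by (intro exI[of _ "[c]"]) auto
  next
    case 4
    have "1 \<le> m - 2 * e" "m - 2 * e < m" using 4 e by auto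
    then obtain w where w: "cfword w" "cfnorm w ^ 2 \<le> D * ?q ^ (m - 2 * e)"
      "\<And>y. absv y < 1 / D \<Longrightarrow> absv (cfw w y - x (n + 1)) * ?q ^ (m - 2 * e) = 1"
      using less.IH[of "m - 2 * e" "n + 1"] by blast
    have m: "?q ^ m = ?q ^ (m - 2 * e) * (?q ^ e) ^ 2"
      using 4 by (simp add: power_mult[symmetric] power_add[symmetric] mult.commute)
    have "absv (cfw (b n # w) y - x n) * ?q ^ m = 1" if y: "absv y < 1 / D" for y
    proof -
      have "absv (cfw (b n # w) y - x n) * ?q ^ m =
          (absv (cfw (b n # w) y - x n) * (?q ^ e) ^ 2) * ?q ^ (m - 2 * e)"
        unfolding m by simp
      also have "absv (cfw (b n # w) y - x n) * (?q ^ e) ^ 2 = absv (cfw w y - x (n + 1))"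
        using inverse_add_diff[OF b_gt[of n] cfw_less_one[OF w(1) small[OF y]] x_less[of "n + 1"]]
        by (simp add: xinv[symmetric] b)
      also have "absv (cfw w y - x (n + 1)) * ?q ^ (m - 2 * e) = 1" by (rule w(3)[OF y])
      finally show ?thesis .
    qed
    moreover have "cfnorm (b n # w) ^ 2 \<le> D * ?q ^ m"
      unfolding m using mult_right_mono[OF w(2), of "(?q ^ e) ^ 2"]
      by (simp add: b power_mult_distrib mult.commute mult.left_commute)
    ultimately show ?thesis using w(1) b_Rpoly b_gt by (intro exI[of _ "b n # w"]) auto
  qed
qed

section \<open>Fixed points of finite continued fractions\<close>

lemma fls_limit:
  fixes y :: "nat \<Rightarrow> 'a::{finite,field} fls"
  assumes "\<And>n. absv (y (Suc n) - y n) < real CARD('a) powr (- real_of_int (int n))"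
  shows "\<exists>f. \<forall>n. absv (f - y n) < real CARD('a) powr (- real_of_int (int n))"
proof -
  have step: "fls_nth (y (Suc n)) i = fls_nth (y n) i" if "i \<le> int n" for n i
    using assms[of n] that unfolding absv_less_powr_iff by simp
  have stable: "fls_nth (y k) i = fls_nth (y n) i" if "n \<le> k" "i \<le> int n" for n k i
    using that(1) by (induction k rule: dec_induct) (use step that(2) in auto)
  \<comment> \<open>The diagonal: coefficient i is constant from index \<open>nat i\<close> on, and
    those of index at most 0 never change.\<close>
  define f where "f = Abs_fls (\<lambda>i. fls_nth (y (nat i)) i)"
  have f: "fls_nth f i = fls_nth (y (nat i)) i" for i
    unfolding f_def by (rule nth_Abs_fls_lower_bound[of "min 0 (fls_subdegree (y 0))"]) auto
  have "absv (f - y n) < real CARD('a) powr (- real_of_int (int n))" for n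
    unfolding absv_less_powr_iff using stable[of "nat i" n i for i] by (auto simp: f)
  thus ?thesis by blast
qed

lemma cfnorm_ge_card:
  assumes "cfword w" "w \<noteq> []" shows "real CARD('a) \<le> cfnorm (w :: 'a::{finite,field} fls list)"
proof (cases w)
  case (Cons a v)
  hence "real CARD('a) * 1 \<le> absv a * cfnorm v"
    using assms(1) by (intro mult_mono absv_gt_one cfnorm_ge_one) auto
  thus ?thesis using Cons by simp
qed (use assms in simp)

lemma cfw_contraction:
  fixes y z :: "'a::{finite,field} fls"
  assumes "cfword w" "w \<noteq> []" "absv y < 1" "absv z < 1"
  shows "absv (cfw w y - cfw w z) * real CARD('a) \<le> absv (y - z)"
proof -
  have "1 * real CARD('a) \<le> cfnorm w * cfnorm w"
    using assms cfnorm_ge_one[OF assms(1)] by (intro mult_mono cfnorm_ge_card) auto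
  hence "absv (cfw w y - cfw w z) * real CARD('a) \<le> absv (cfw w y - cfw w z) * cfnorm w ^ 2"
    by (intro mult_left_mono) (auto simp: power2_eq_square)
  also have "\<dots> = absv (y - z)" by (rule cfw_diff[OF assms(1,3,4)])
  finally show ?thesis .
qed

text \<open>Banach iteration from 0 with ratio 1/q; the fixed point is the purely periodic expansion
  with period w.\<close>

lemma cfw_fixed_point:
  assumes w: "cfword w" "w \<noteq> []"
  shows "\<exists>f::'a::{finite,field} fls. absv f < 1 \<and> cfw w f = f"
proof -
  let ?q = "real CARD('a)"
  note q = card_gt_one[where 'a='a]
  define y where "y n = (cfw w ^^ n) (0::'a fls)" for n
  have ySuc: "y (Suc n) = cfw w (y n)" for n by (simp add: y_def)
  have y1: "absv (y n) < 1" for n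
    by (induction n) (auto simp: ySuc cfw_less_one[OF w(1)], simp add: y_def)
  have pw: "?q powr (- real_of_int (int (Suc n))) * ?q = ?q powr (- real_of_int (int n))" for n
    using powr_add[of ?q "- real_of_int (int (Suc n))" 1] q by simp
  have "absv (y (Suc n) - y n) < ?q powr (- real_of_int (int n))" for n
  proof (induction n)
    case 0
    have "absv (y (Suc 0) - y 0) < 1" by (intro absv_diff_less y1)
    thus ?case using q by simp
  next
    case (Suc n)
    have "absv (y (Suc (Suc n)) - y (Suc n)) * ?q \<le> absv (y (Suc n) - y n)"
      unfolding ySuc[of "Suc n"] by (subst ySuc[of n]) (intro cfw_contraction w y1)
    hence "absv (y (Suc (Suc n)) - y (Suc n)) * ?q < ?q powr (- real_of_int (int (Suc n))) * ?q"
      using Suc unfolding pw by linarith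
    thus ?case using q by simp
  qed
  then obtain f where f: "\<And>n. absv (f - y n) < ?q powr (- real_of_int (int n))"
    using fls_limit by blast
  have f1: "absv f < 1"
    using f[of 0] q by (simp add: y_def)
  have "absv (cfw w f - f) < ?q powr (- real_of_int k)" for k
  proof -
    let ?n = "nat k"
    have le: "?q powr (- real_of_int (int ?n)) \<le> ?q powr (- real_of_int k)" by simp
    have "absv (cfw w f - y (Suc ?n)) * 1 \<le> absv (cfw w f - y (Suc ?n)) * ?q"
      using q by (intro mult_left_mono) auto
    also have "\<dots> \<le> absv (f - y ?n)" unfolding ySuc by (intro cfw_contraction w y1 f1)
    finally have 1: "absv (cfw w f - y (Suc ?n)) < ?q powr (- real_of_int k)" using f[of ?n] le by linarith
    have "?q powr (- real_of_int (int (Suc ?n))) \<le> ?q powr (- real_of_int k)" by simp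
    with f[of "Suc ?n"] have "absv (f - y (Suc ?n)) < ?q powr (- real_of_int k)" by linarith
    with 1 show ?thesis using absv_diff_less[of "cfw w f - y (Suc ?n)" _ "f - y (Suc ?n)"] by simp
  qed
  hence "fls_nth (cfw w f - f) i = 0" for i unfolding absv_less_powr_iff by blast
  hence "cfw w f = f" by (simp add: fls_eq_iff)
  with f1 show ?thesis by blast
qed

text \<open>The Euclidean algorithm: each letter lowers the degree of the denominator by at least 1.
  Arbitrarily long expansions thus exclude rational values.\<close>

lemma cfw_rational_length:
  fixes y :: "'a::{finite,field} fls"
  assumes "cfword w" "absv y < 1" "u \<in> Rpoly" "v \<in> Rpoly" "v \<noteq> 0" "cfw w y * v = u"
  shows "real CARD('a) ^ length w \<le> absv v"
  using assms
proof (induction w arbitrary: u v)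
  case Nil
  thus ?case using absv_Rpoly_ge_one by simp
next
  case (Cons a w)
  define t where "t = cfw w y"
  have a: "a \<in> Rpoly" "1 < absv a" "cfword w" using Cons.prems by auto
  have "absv (a + t) = absv a" using a Cons.prems by (intro absv_add_small) (auto simp: t_def cfw_less_one)
  hence nz: "a + t \<noteq> 0" using a(2) by fastforce
  have v: "v = u * (a + t)" using Cons.prems(6) nz by (simp add: t_def[symmetric] field_simps)
  hence "u \<noteq> 0" using Cons.prems by auto
  have tu: "t * u = v - u * a" using v by (simp add: algebra_simps)
  have "real CARD('a) ^ length w \<le> absv u"
  proof (rule Cons.IH[OF a(3) Cons.prems(2) _ Cons.prems(3) \<open>u \<noteq> 0\<close>])
    show "v - u * a \<in> Rpoly" using a Cons.prems by (intro Rpoly_diff Rpoly_mult)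
    show "cfw w y * u = v - u * a" using tu by (simp add: t_def)
  qed
  hence "real CARD('a) ^ length w * real CARD('a) \<le> absv u * absv a"
    using a by (intro mult_mono absv_gt_one) auto
  also have "\<dots> = absv (u * (a + t))" using \<open>absv (a + t) = absv a\<close> by (simp add: absv_mult)
  also have "\<dots> = absv v" by (simp only: v[symmetric])
  finally show ?case by (simp add: mult.commute)
qed

lemma cfw_Theta:
  assumes "conjp \<alpha> \<alpha>'" "cfword w" "y \<in> Theta \<alpha>"
  shows "cfw w y \<in> Theta \<alpha> \<and> qconj (cfw w y) = cfw w (qconj y)"
  using assms(2)
proof (induction w)
  case Nil
  thus ?case using assms(3) by simp
next
  case (Cons a w)
  hence "cfw w y \<in> Theta \<alpha>" "- a \<in> Rpoly" and q: "qconj (cfw w y) = cfw w (qconj y)" by auto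
  from Theta_cf_step[OF assms(1) this(1,2)] q show ?case by (simp add: add.commute)
qed

primrec uncfw :: "'a::field fls list \<Rightarrow> 'a fls \<Rightarrow> 'a fls" where
  "uncfw [] y = y"
| "uncfw (a # w) y = uncfw w (inverse y - a)"

lemma cfw_uncfw: "cfw w (uncfw w y) = y"
  by (induction w arbitrary: y) simp_all

lemma uncfw_Theta:
  assumes "conjp \<alpha> \<alpha>'" "cfword w" "y \<in> Theta \<alpha>"
  shows "uncfw w y \<in> Theta \<alpha>"
  using assms(2,3)
proof (induction w arbitrary: y)
  case (Cons a w)
  have g: "gl2 (- a) 1 1 0" using Cons.prems by (auto simp: gl2_def intro!: bexI[of _ "- 1"])
  have "y \<noteq> 0" using conjpD(1)[OF Theta_conjp[OF assms(1) Cons.prems(2)]] by auto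
  hence "mob (- a) 1 1 0 y = inverse y - a" by (simp add: mob_def field_simps)
  thus ?case using Theta_mob[OF assms(1) Cons.prems(2) g] Cons by auto
qed simp

text \<open>The ball of radius 1/\<open>cfnorm\<close>^2 around a value of \<open>cfw w\<close>
  contains only points whose expansion begins with w.\<close>

lemma uncfw_less_one:
  assumes "cfword w" "absv z < 1" "absv (cfw w z - y) * cfnorm w ^ 2 < 1"
  shows "absv (uncfw w y) < 1"
  using assms(1,3)
proof (induction w arbitrary: y)
  case Nil
  thus ?case using assms(2) absv_diff_less[of z 1 "z - y"] by simp
next
  case (Cons a w)
  define t where "t = cfw w z"
  have w: "a \<in> Rpoly" "1 < absv a" "cfword w" using Cons.prems by auto
  have at: "absv (a + t) = absv a" using w assms(2) by (intro absv_add_small) (auto simp: t_def cfw_less_one)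
  hence nz: "a + t \<noteq> 0" using w(2) by fastforce
  have lt: "absv (inverse (a + t) - y) * absv a ^ 2 * cfnorm w ^ 2 < 1"
    using Cons.prems(2) by (simp add: t_def power_mult_distrib mult.assoc)
  have "absv (inverse (a + t) - y) * absv a * 1 \<le> absv (inverse (a + t) - y) * absv a * (absv a * cfnorm w ^ 2)"
  proof (intro mult_left_mono)
    have "1 * 1 \<le> absv a * cfnorm w ^ 2"
      using w cfnorm_ge_one[OF w(3)] by (intro mult_mono) (auto simp: one_le_power)
    thus "1 \<le> absv a * cfnorm w ^ 2" by simp
  qed auto
  hence "absv (inverse (a + t) - y) * absv a < 1" using lt by (simp add: power2_eq_square mult.assoc)
  \<comment> \<open>Closer than its own size to 1/(a + t), the point y has size 1/|a|; inverting
    multiplies the distance by |a|^2, which fits the induction hypothesis.\<close>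
  hence "absv (inverse (a + t) - y) < absv (inverse (a + t))"
    unfolding absv_inverse at inverse_eq_divide[of "absv a"] using w(2)
    by (subst pos_less_divide_eq) linarith+
  hence y: "absv y = inverse (absv a)" using absv_cong by (metis absv_inverse at)
  hence "y \<noteq> 0" using w(2) by fastforce
  have "(inverse g - y) * (g * inverse y) = inverse y - g" if "g \<noteq> 0" for g
    using that \<open>y \<noteq> 0\<close> by (simp add: field_simps)
  from this[OF nz] have "t - (inverse y - a) = - ((inverse (a + t) - y) * ((a + t) * inverse y))" by simp
  hence "absv (t - (inverse y - a)) = absv (inverse (a + t) - y) * absv a ^ 2"
    by (simp add: absv_mult at y absv_inverse power2_eq_square)
  with lt show ?case using Cons.IH[OF w(3), of "inverse y - a"] by (simp add: t_def)
qed

section \<open>Realising the values\<close>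

text \<open>Normalised form of the comparison of the intervals \<open>[v, u]\<close> and \<open>[vj, B]\<close> of radii along which the
  geodesic line towards \<open>f\<close> follows two geodesic lines of the orbit.\<close>

lemma overlap_comparison:
  fixes u v vj B D E :: real
  assumes pos: "0 < vj" "0 < u" "0 \<le> v" "1 \<le> B" "1 < D" "1 \<le> E"
    and "v < u" "vj < B" and u: "u \<le> D" and v: "vj \<le> v * D ^ 2"
    and M: "D ^ 2 * E ^ 2 * vj \<le> B"
    and rig: "u * B \<le> max v vj * max u B * E ^ 2"
  shows "u * vj \<le> v * B"
proof (rule ccontr)
  assume "\<not> ?thesis"
  hence c: "v * B < u * vj" by simp
  have E: "1 \<le> E ^ 2" using pos by (simp add: one_le_power)
  have D: "1 < D ^ 2" "D < D ^ 2" using pos by (simp_all add: power2_eq_square less_1_mult)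
  show False
  \<comment> \<open>If u is at least B, cancelling u in \<open>rig\<close> leaves B \<le> max v vj *
    E^2, which is incompatible with \<open>M\<close> and the assumed failure.\<close>
  proof (cases "u \<ge> B")
    case True
    hence "u * B \<le> u * (max v vj * E ^ 2)" using rig by (simp add: max_absorb1 mult.commute mult.left_commute)
    hence b: "B \<le> max v vj * E ^ 2" using pos by simp
    show False
    proof (cases "vj \<le> v")
      case True
      hence "B * B \<le> (v * B) * E ^ 2" using b pos by (simp add: max_absorb1 mult.commute mult.left_commute)
      also have "\<dots> < (u * vj) * E ^ 2" using c E by (intro mult_strict_right_mono) auto
      also have "\<dots> \<le> (D * vj) * E ^ 2" using u pos by (intro mult_right_mono) auto
      also have "\<dots> \<le> D ^ 2 * E ^ 2 * vj" using D(2) pos by (simp add: mult.commute mult.left_commute mult_left_mono)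
      also have "\<dots> \<le> B" by (rule M)
      finally show False using pos by simp
    next
      case False
      hence "B \<le> 1 * (vj * E ^ 2)" using b by simp
      also have "\<dots> < D ^ 2 * (vj * E ^ 2)" using D(1) pos E by (intro mult_strict_right_mono) auto
      also have "\<dots> \<le> B" using M by (simp add: mult.commute mult.left_commute)
      finally show False by simp
    qed
  next
    case False
    have "v < vj"
    proof (rule ccontr)
      assume "\<not> ?thesis"
      hence "u * vj \<le> u * v" using pos by (intro mult_left_mono) auto
      also have "\<dots> \<le> B * v" using False pos by (intro mult_right_mono) auto
      finally show False using c by (simp add: mult.commute)
    qed
    \<comment> \<open>The two pieces of the overlap: u/vj is at most E^2 by rigidity and vj/v at
      most D^2, so u/v is at most D^2 E^2, hence at most B/vj.\<close>
    hence "u * B \<le> B * (vj * E ^ 2)" using rig False by (simp add: max_absorb2 mult.commute mult.left_commute)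
    hence "u \<le> vj * E ^ 2" using pos by (simp add: mult.commute[of u])
    hence "D ^ 2 * (u * vj) \<le> D ^ 2 * ((vj * E ^ 2) * vj)" using pos by (intro mult_left_mono mult_right_mono) auto
    also have "\<dots> = vj * (D ^ 2 * E ^ 2 * vj)" by (simp add: mult.commute mult.left_commute)
    also have "\<dots> \<le> vj * B" using M pos by (intro mult_left_mono) auto
    also have "\<dots> \<le> (v * D ^ 2) * B" using v pos by (intro mult_right_mono) auto
    finally have "D ^ 2 * (u * vj) \<le> D ^ 2 * (v * B)" by (simp add: mult.commute mult.left_commute)
    hence "u * vj \<le> v * B" by (rule mult_left_le_imp_le) (use D in linarith)
    with c show False by simp
  qed
qed

lemma Theta_inverse_diff:
  assumes "conjp \<alpha> \<alpha>'" "y \<in> Theta \<alpha>" "\<And>\<beta>. \<beta> \<in> Theta \<alpha> \<Longrightarrow> absv (\<beta> - qconj \<beta>) \<le> D"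
  shows "absv (inverse y - inverse (qconj y)) \<le> D"
  using Theta_cf_step[OF assms(1,2), of 0] assms(3)[of "inverse y"] by simp

section \<open>Lines of the orbit near a high horoball\<close>

context biperiodic
begin

text \<open>A line of the orbit that follows the line towards \<open>f\<close> cannot reach the top of a horoball in which the
  latter climbs higher than \<open>D\<close>: it leaves before or joins after.\<close>

lemma horoball_dichotomy:
  assumes w: "cfword w" and f: "absv f < 1 / D" "cfw w f = f" and \<beta>: "\<beta> \<in> Theta (x 0)"
    and lt: "absv (f - \<beta>) < absv (\<beta> - qconj \<beta>)" and close: "absv (f - \<beta>) * cfnorm w ^ 2 * D < 1"
  shows "absv (\<beta> - qconj \<beta>) * cfnorm w ^ 2 \<le> D * absv f ^ 2"
proof -
  note D = D_gt_one
  have f1: "absv f < 1" using f(1) D by (smt (verit) divide_le_eq_1)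
  \<comment> \<open>Pulling back by w brings the horoball to the origin of the unit ball.\<close>
  define y where "y = uncfw w \<beta>"
  have yT: "y \<in> Theta (x 0)" unfolding y_def by (rule uncfw_Theta[OF conjp_x w \<beta>])
  have y\<beta>: "cfw w y = \<beta>" by (simp add: y_def cfw_uncfw)
  have y'\<beta>: "cfw w (qconj y) = qconj \<beta>" using cfw_Theta[OF conjp_x w yT] y\<beta> by simp
  have N: "0 < cfnorm w ^ 2" using cfnorm_ge_one[OF w] by simp
  have "absv (cfw w f - \<beta>) * cfnorm w ^ 2 * 1 \<le> absv (cfw w f - \<beta>) * cfnorm w ^ 2 * D"
    using D by (intro mult_left_mono) auto
  hence "absv (cfw w f - \<beta>) * cfnorm w ^ 2 < 1" using close f(2) by simp
  hence y1: "absv y < 1" unfolding y_def by (rule uncfw_less_one[OF w f1])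
  have fy: "absv (f - \<beta>) * cfnorm w ^ 2 = absv (f - y)"
    using cfw_diff[OF w f1 y1] by (simp add: f(2) y\<beta>)
  hence "absv (f - y) < 1 / D" using close D by (simp add: field_simps)
  hence yD: "absv y < 1 / D" using absv_diff_less[OF f(1), of "f - y"] by simp
  note cy = conjpD[OF Theta_conjp[OF conjp_x yT]]
  have nz: "y \<noteq> 0" "qconj y \<noteq> 0" using cy(1,2) by auto
  have inv: "absv (inverse y - inverse (qconj y)) \<le> D"
    by (rule Theta_inverse_diff[OF conjp_x yT Theta_diff_le])
  \<comment> \<open>A conjugate outside the unit ball would put 1/y within D of a point of size at
    most 1, against |y| < 1/D.\<close>
  have y'1: "absv (qconj y) < 1"
  proof (rule ccontr)
    assume "\<not> ?thesis"
    hence "absv (inverse (qconj y)) \<le> 1" by (simp add: absv_inverse inverse_le_1_iff)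
    hence "absv (inverse y) \<le> D"
      using inv D absv_add_le[of "inverse y - inverse (qconj y)" "inverse (qconj y)"] by simp
    hence "1 \<le> D * absv y" using nz unfolding absv_inverse by (simp add: inverse_eq_divide divide_le_eq)
    thus False using yD D by (simp add: field_simps)
  qed
  have U: "absv (\<beta> - qconj \<beta>) * cfnorm w ^ 2 = absv (y - qconj y)"
    using cfw_diff[OF w y1 y'1] by (simp add: y\<beta> y'\<beta>)
  have "inverse y - inverse (qconj y) = (qconj y - y) / (y * qconj y)" using nz by (simp add: field_simps)
  hence "absv (y - qconj y) \<le> D * (absv y * absv (qconj y))"
    using inv nz by (simp add: absv_divide absv_mult absv_minus_commute[of "qconj y" y] divide_le_eq)
  moreover have "D * absv y < 1" using yD D by (simp add: field_simps)
  hence "(D * absv y) * absv (qconj y) < 1 * absv (qconj y)" using nz by (intro mult_strict_right_mono) auto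
  ultimately have le: "absv (y - qconj y) \<le> D * absv y * absv (qconj y)"
    and "absv (qconj y - y) < absv (qconj y)" by (simp_all add: absv_minus_commute[of "qconj y" y])
  hence eq: "absv (qconj y) = absv y" using absv_cong[of "qconj y" y] by simp
  \<comment> \<open>Both distances |f - y| and |y - qconj y| are below |y|, so f has the size of y
    and may replace it in the bound.\<close>
  have "absv (f - y) < absv (y - qconj y)" unfolding fy[symmetric] U[symmetric] using lt N by simp
  also have "\<dots> < absv y" using \<open>absv (qconj y - y) < _\<close> eq by (simp add: absv_minus_commute)
  finally have "absv f = absv y" using absv_cong[of y f] by (simp add: absv_minus_commute)
  thus ?thesis unfolding U using le eq by (simp add: power2_eq_square mult.assoc)
qed

end

section \<open>Construction of f and computation of the limit inferior\<close>

context biperiodic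
begin

lemma realise_value:
  assumes M: "D ^ 2 * (D ^ s) ^ 2 \<le> real CARD('a) ^ m"
  shows "\<exists>f. f \<notin> Kfrac \<and> f \<notin> Theta (x 0) \<and> capprox (x 0) f = ereal (inverse (real CARD('a) ^ m))"
proof -
  let ?q = "real CARD('a)" and ?T = "Theta (x 0)"
  note q = card_gt_one[where 'a='a] and D = D_gt_one and conj = conjp_x[of 0]
  define B where "B = absv (x' 0)"
  define e where "e = degY (x' 0)"
  have B: "1 < B" "B \<le> D" "B = ?q ^ e"
    using x'_gt[of 0] x'_le[of 0] degY_absv[of "x' 0"] q by (simp_all add: B_def e_def powr_realpow)
  have E: "1 \<le> D ^ s" using D by simp
  have E2: "1 \<le> (D ^ s) ^ 2" using E by (simp add: one_le_power)
  have "1 * D < D * D" using D by (intro mult_strict_right_mono) auto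
  hence "?q ^ e < D ^ 2 * 1" using B by (simp only: power2_eq_square)
  also have "\<dots> \<le> D ^ 2 * (D ^ s) ^ 2" using E2 by (intro mult_left_mono) auto
  finally have "?q ^ e < ?q ^ m" using M by linarith
  hence em: "e < m" using q by simp
  \<comment> \<open>In normalised radii the axis of x 0 starts at q^e, so a distance of q^-m' from x
    0 gives a shared piece of length e + m' = m.\<close>
  define m' where "m' = m - e"
  have qm: "?q ^ m = B * ?q ^ m'" using em by (simp add: B m'_def power_add[symmetric])
  have "1 \<le> m'" using em by (simp add: m'_def)
  then obtain w where w: "cfword w" "cfnorm w ^ 2 \<le> D * ?q ^ m'"
    "\<And>y. absv y < 1 / D \<Longrightarrow> absv (cfw w y - x 0) * ?q ^ m' = 1"
    using approximating_word[of m' 0] by blast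
  obtain k where k: "D < ?q ^ k" using real_arch_pow[OF q] by blast
  \<comment> \<open>A letter larger than D: its horoball is higher than any line of the orbit
    climbs, which separates consecutive copies of w.\<close>
  define A where "A = (fls_X_inv ^ k :: 'a fls)"
  have A: "A \<in> Rpoly" "D < absv A" using k q by (simp_all add: A_def absv_X_inv_power powr_realpow)
  have A1: "1 < absv A" using A D by simp
  hence A0: "A \<noteq> 0" by fastforce
  have Aw: "cfword (A # w)" using A A1 w by simp
  obtain f where f: "absv f < 1" "cfw (A # w) f = f" using cfw_fixed_point[OF Aw] by blast
  have wf1: "absv (cfw w f) < 1" by (rule cfw_less_one[OF w(1) f(1)])
  have absf: "absv f = inverse (absv A)"
    using f(2) absv_add_small[OF A1 wf1] by (metis absv_inverse cfw.simps(2))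
  have fD: "absv f < 1 / D" unfolding absf inverse_eq_divide using A A0 D by (intro divide_strict_left_mono) auto
  define W where "W j = concat (replicate j (A # w))" for j
  define Q where "Q = cfnorm (A # w)"
  have W0: "W 0 = []" and WSuc: "W (Suc j) = (A # w) @ W j" for j by (simp_all add: W_def)
  have W: "cfword (W j)" "cfnorm (W j) = Q ^ j" "cfw (W j) f = f" "j \<le> length (W j)" for j
  proof (induction j)
    case (Suc j)
    show "cfword (W (Suc j))" using Aw Suc by (simp add: WSuc)
    show "cfnorm (W (Suc j)) = Q ^ Suc j" using Suc by (simp add: WSuc Q_def)
    show "cfw (W (Suc j)) f = f" by (simp only: WSuc cfw_append Suc f(2))
    show "Suc j \<le> length (W (Suc j))" using Suc by (simp add: WSuc)
  qed (simp_all add: W0)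
  have Q: "1 < Q" using cfnorm_ge_card[OF Aw] q by (simp add: Q_def)
  have QA: "Q = absv A * cfnorm w" by (simp add: Q_def)

  \<comment> \<open>A line that follows f beyond the horoball after j copies starts only below
    it.\<close>
  have dich: "absv (\<beta> - qconj \<beta>) * (Q ^ j * absv A) ^ 2 \<le> D"
    if "\<beta> \<in> ?T" "absv (f - \<beta>) < absv (\<beta> - qconj \<beta>)" "absv (f - \<beta>) * (Q ^ j) ^ 2 * D < 1" for \<beta> j
  proof -
    have "absv (\<beta> - qconj \<beta>) * (Q ^ j) ^ 2 \<le> D * absv f ^ 2"
      using horoball_dichotomy[OF W(1) fD W(3) that(1,2)] that(3) by (simp add: W(2))
    hence "absv (\<beta> - qconj \<beta>) * (Q ^ j) ^ 2 * absv A ^ 2 \<le> D * absv f ^ 2 * absv A ^ 2"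
      by (intro mult_right_mono) auto
    also have "\<dots> = D * (absv f * absv A) ^ 2" by (simp add: power_mult_distrib)
    also have "absv f * absv A = 1" using A0 by (simp add: absf)
    finally show ?thesis by (simp add: power_mult_distrib mult.assoc)
  qed

  have grow: "\<exists>j. D < c * (Q ^ j * absv A) ^ 2" if "0 < c" for c :: real
  proof -
    obtain j where j: "D / c < Q ^ j" using real_arch_pow[OF Q] by blast
    have "1 * Q ^ j \<le> (Q ^ j * absv A) * (Q ^ j * absv A)"
      using A1 Q mult_mono[of 1 "Q ^ j" 1 "absv A"] mult_mono[of 1 "Q ^ j * absv A" "Q ^ j" "Q ^ j * absv A"] by simp
    hence "D / c < (Q ^ j * absv A) ^ 2" using j by (simp add: power2_eq_square)
    thus ?thesis using that by (auto simp: field_simps)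
  qed

  have fT: "f \<notin> ?T"
  proof
    assume fT: "f \<in> ?T"
    \<comment> \<open>A point of the orbit equal to f would have distance 0, so \<open>dich\<close>
      would apply for every j and force its conjugate distance to 0.\<close>
    have U: "0 < absv (f - qconj f)" using conjpD(3)[OF Theta_conjp[OF conj fT]] by simp
    then obtain j where "D < absv (f - qconj f) * (Q ^ j * absv A) ^ 2" using grow by blast
    moreover have "absv (f - qconj f) * (Q ^ j * absv A) ^ 2 \<le> D" using U by (intro dich fT) auto
    ultimately show False by simp
  qed

  have fK: "f \<notin> Kfrac"
  proof
    assume "f \<in> Kfrac"
    then obtain u v where uv: "u \<in> Rpoly" "v \<in> Rpoly" "v \<noteq> 0" "f = u / v" by (rule KfracE)
    obtain j where j: "absv v < ?q ^ j" using real_arch_pow[OF q] by blast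
    have "?q ^ length (W j) \<le> absv v"
    proof (rule cfw_rational_length[OF W(1) f(1) uv(1-3)])
      have "f * v = u" using uv(3,4) by simp
      thus "cfw (W j) f * v = u" by (simp only: W(3))
    qed
    moreover have "?q ^ j \<le> ?q ^ length (W j)" using q W(4) by (intro power_increasing) auto
    ultimately show False using j by simp
  qed

  \<comment> \<open>The axis of x 0 moved behind the letter A, and then behind j further periods:
    these orbit points attain the ratio exactly.\<close>
  define z where "z = cfw [A] (x 0)"
  define \<beta> where "\<beta> j = cfw (W j) z" for j
  have A': "cfword [A]" using A A1 by simp
  have zT: "z \<in> ?T" "qconj z = cfw [A] (x' 0)"
    using cfw_Theta[OF conj A' Theta_self[OF conj]] conjp_qconj[OF conj] by (simp_all add: z_def)
  have z1: "absv z < 1" unfolding z_def by (rule cfw_less_one[OF A' x_less])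
  have AB: "absv (A + x' 0) = absv A" using B A by (intro absv_add_eq') (simp add: B_def)
  have zz: "absv (z - qconj z) * absv A ^ 2 = B" and z'1: "absv (qconj z) < 1"
  proof -
    have a: "absv (A + x 0) = absv A" by (rule absv_add_small[OF A1 x_less])
    have zi: "qconj z = inverse (A + x' 0)" "z = inverse (A + x 0)" using zT(2) by (simp_all add: z_def)
    have nz: "A + x 0 \<noteq> 0" "A + x' 0 \<noteq> 0" using a AB A1 by fastforce+
    have "z - qconj z = inverse (A + x 0) - inverse (A + x' 0)" by (simp only: zi(1)) (simp only: zi(2))
    also have "\<dots> = (x' 0 - x 0) / ((A + x 0) * (A + x' 0))" using nz by (simp add: field_simps)
    finally have "z - qconj z = (x' 0 - x 0) / ((A + x 0) * (A + x' 0))" .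
    moreover have "A \<noteq> 0" using A1 by fastforce
    ultimately show "absv (z - qconj z) * absv A ^ 2 = B"
      by (simp add: absv_divide absv_mult a AB power2_eq_square absv_minus_commute[of "x' 0" "x 0"] absv_x_diff B_def)
    show "absv (qconj z) < 1" unfolding zi(1) absv_inverse AB using A1 by (simp add: inverse_less_1_iff)
  qed
  have fz: "absv (f - z) * absv A ^ 2 * ?q ^ m' = 1"
  proof -
    have "absv (f - z) * absv A ^ 2 = absv (cfw w f - x 0)"
      using inverse_add_diff[OF A1 wf1 x_less[of 0]] f(2) by (simp add: z_def)
    thus ?thesis using w(3)[OF fD] by simp
  qed
  have \<beta>T: "\<beta> j \<in> ?T" "qconj (\<beta> j) = cfw (W j) (qconj z)" for j
    using cfw_Theta[OF conj W(1) zT(1)] by (simp_all add: \<beta>_def)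
  have "absv (\<beta> j - qconj (\<beta> j)) * (Q ^ j) ^ 2 = absv (z - qconj z)" for j
    using cfw_diff[OF W(1)[of j] z1 z'1] by (simp only: \<beta>T(2) W(2) \<beta>_def[symmetric])
  hence Uj: "absv (\<beta> j - qconj (\<beta> j)) * (Q ^ j * absv A) ^ 2 = B" for j
    using zz by (simp add: power_mult_distrib mult.assoc[symmetric])
  have "absv (f - \<beta> j) * (Q ^ j) ^ 2 = absv (f - z)" for j
    using cfw_diff[OF W(1)[of j] f(1) z1] by (simp only: W(2,3) \<beta>_def[symmetric])
  hence Vj: "absv (f - \<beta> j) * (Q ^ j * absv A) ^ 2 * ?q ^ m' = 1" for j
    using fz by (simp add: power_mult_distrib mult.assoc[symmetric])
  have ratio: "absv (f - \<beta> j) / absv (\<beta> j - qconj (\<beta> j)) = inverse (?q ^ m)" for j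
  proof -
    have p: "(Q ^ j * absv A) ^ 2 \<noteq> 0" using Q A0 by simp
    have "absv (f - \<beta> j) * ?q ^ m = absv (\<beta> j - qconj (\<beta> j))"
    proof -
      have "(absv (f - \<beta> j) * ?q ^ m) * (Q ^ j * absv A) ^ 2 =
          B * (absv (f - \<beta> j) * (Q ^ j * absv A) ^ 2 * ?q ^ m')"
        by (simp add: qm)
      also have "\<dots> = absv (\<beta> j - qconj (\<beta> j)) * (Q ^ j * absv A) ^ 2" by (simp only: Uj Vj)
      finally show ?thesis by (rule mult_right_cancel[OF p, THEN iffD1])
    qed
    moreover have "absv (\<beta> j - qconj (\<beta> j)) \<noteq> 0" using Uj[of j] B by auto
    ultimately show ?thesis using q by (simp add: field_simps)
  qed

  obtain \<omega> \<omega>' where om: "qf \<omega> \<omega>' (x 0) (x' 0)" "\<omega> + \<omega>' \<in> Rpoly" "absv (\<omega> - \<omega>') \<le> D ^ s"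
    by (rule discriminant_root_le)
  have qfT: "qf \<omega> \<omega>' y (qconj y)" if "y \<in> ?T" for y
    using that
  proof (rule ThetaE[OF conj])
    fix a b c d assume g: "gl2 a b c d" "y = mob a b c d (x 0)" "qconj y = mob a b c d (x' 0)"
    show ?thesis unfolding g(3) unfolding g(2)
      by (intro qf_mob[OF om(1,2) g(1)] gl2_denom_nonzero[OF g(1)] conjpD[OF conj])
  next
    fix a b c d assume g: "gl2 a b c d" "y = mob a b c d (x' 0)" "qconj y = mob a b c d (x 0)"
    show ?thesis unfolding g(3) unfolding g(2)
      by (intro qf_mob[OF qf_swap[OF om(1,2)] om(2) g(1)] gl2_denom_nonzero[OF g(1)] conjpD[OF conj])
  qed

  have lower: "inverse (?q ^ m) \<le> absv (f - y) / absv (y - qconj y)"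
    if yT: "y \<in> ?T" and small: "absv (y - qconj y) * absv A ^ 2 \<le> D" for y
  proof -
    define U V where "U = absv (y - qconj y)" and "V = absv (f - y)"
    note cy = conjpD[OF Theta_conjp[OF conj yT]]
    have U: "0 < U" using cy(3) by (simp add: U_def)
    have "U \<le> V * ?q ^ m"
    proof (cases "U \<le> V")
      case True
      have "U * 1 \<le> V * ?q ^ m" using True U q by (intro mult_mono) auto
      thus ?thesis by simp
    next
      case False
      \<comment> \<open>The copy in which the line of y starts: its rescaled upper radius is at most
        D behind the letter A of copy j, but not behind the next one.\<close>
      obtain j where j: "U * (Q ^ j * absv A) ^ 2 \<le> D" "\<not> U * (Q ^ Suc j * absv A) ^ 2 \<le> D"
      proof -
        have "\<exists>j. U * (Q ^ j * absv A) ^ 2 \<le> D \<and> \<not> U * (Q ^ Suc j * absv A) ^ 2 \<le> D"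
        proof (rule ccontr)
          assume "\<not> ?thesis"
          hence *: "U * (Q ^ j * absv A) ^ 2 \<le> D \<Longrightarrow> U * (Q ^ Suc j * absv A) ^ 2 \<le> D" for j by blast
          have "U * (Q ^ j * absv A) ^ 2 \<le> D" for j
            by (induction j) (use small * in \<open>auto simp: U_def\<close>)
          thus False using grow[OF U] by (meson not_less)
        qed
        thus thesis using that by blast
      qed
      \<comment> \<open>Multiplication by a rescales the radii of copy j to unit scale, where the
        axis of \<open>\<beta> j\<close> shares the radii from vj to B.\<close>
      define a where "a = (Q ^ j * absv A) ^ 2"
      have a: "0 < a" using Q A0 by (simp add: a_def)
      \<comment> \<open>Since the line starts before the next horoball, \<open>dich\<close> forbids
        it to follow f past that one; with the bound on \<open>cfnorm w\<close> this bounds V from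
        below.\<close>
      have "\<not> V * (Q ^ Suc j) ^ 2 * D < 1"
        using dich[OF yT, of "Suc j"] False j(2) by (auto simp: U_def V_def)
      hence "1 \<le> V * (Q ^ Suc j) ^ 2 * D" by simp
      also have "(Q ^ Suc j) ^ 2 = a * cfnorm w ^ 2"
        by (simp add: a_def QA power_mult_distrib mult.commute mult.left_commute)
      also have "V * (a * cfnorm w ^ 2) * D \<le> V * (a * (D * ?q ^ m')) * D"
        using w(2) a D by (intro mult_right_mono mult_left_mono) (auto simp: V_def)
      finally have v: "1 \<le> V * a * D ^ 2 * ?q ^ m'" by (simp add: power2_eq_square mult.commute mult.left_commute)
      define vj where "vj = inverse (?q ^ m')"
      have vjq: "vj * ?q ^ m' = 1" "0 < vj" "vj \<le> 1" using q by (simp_all add: vj_def inverse_le_1_iff)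
      have V_j: "absv (f - \<beta> j) * a = vj" and U_j: "absv (\<beta> j - qconj (\<beta> j)) * a = B"
        using Vj[of j] Uj[of j] q by (simp_all add: a_def vj_def field_simps)
      have "(U * a) * vj \<le> (V * a) * B"
      proof (cases "y = \<beta> j")
        case True
        thus ?thesis using V_j U_j by (simp add: U_def V_def mult.commute)
      next
        case ne: False
        have ne': "qconj y \<noteq> qconj (\<beta> j)"
          using ne conjp_qconj[OF conjp_sym[OF Theta_conjp[OF conj yT]]]
            conjp_qconj[OF conjp_sym[OF Theta_conjp[OF conj \<beta>T(1)]], of j] by metis
        show ?thesis
        proof (rule overlap_comparison[where D = D and E = "D ^ s"])
          have yb: "absv (y - \<beta> j) * a \<le> max (V * a) vj"
          proof -
            have "absv (y - \<beta> j) \<le> max V (absv (f - \<beta> j))"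
              using absv_diff_triangle[of y "\<beta> j" f] by (simp add: V_def absv_minus_commute)
            hence "absv (y - \<beta> j) * a \<le> max V (absv (f - \<beta> j)) * a" using a by (intro mult_right_mono) auto
            thus ?thesis using a V_j by (simp add: max_mult_distrib_right)
          qed
          have "V * a < U * a" "vj < B" using False a vjq B by auto
          hence mx: "max (V * a) vj \<le> max (U * a) B" by auto
          have yb': "absv (qconj y - qconj (\<beta> j)) * a \<le> max (U * a) B"
          proof -
            have "absv (qconj y - qconj (\<beta> j)) \<le> max (max U (absv (y - \<beta> j))) (absv (\<beta> j - qconj (\<beta> j)))"
              using absv_diff_triangle[of "qconj y" "\<beta> j" y] absv_diff_triangle[of "qconj y" "qconj (\<beta> j)" "\<beta> j"]
              by (auto simp: U_def absv_minus_commute[of "qconj y" y])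
            hence "absv (qconj y - qconj (\<beta> j)) * a \<le> max (max U (absv (y - \<beta> j))) (absv (\<beta> j - qconj (\<beta> j))) * a"
              using a by (intro mult_right_mono) auto
            thus ?thesis using a U_j yb mx by (auto simp: max_mult_distrib_right)
          qed
          have "U * absv (\<beta> j - qconj (\<beta> j)) \<le>
              absv (y - \<beta> j) * absv (qconj y - qconj (\<beta> j)) * absv (\<omega> - \<omega>') ^ 2"
            unfolding U_def by (rule qf_rigidity[OF qfT[OF yT] qfT[OF \<beta>T(1)] om(2) ne ne'])
          hence "U * absv (\<beta> j - qconj (\<beta> j)) * (a * a) \<le>
              absv (y - \<beta> j) * absv (qconj y - qconj (\<beta> j)) * absv (\<omega> - \<omega>') ^ 2 * (a * a)"
            using a by (intro mult_right_mono) auto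
          hence "(U * a) * (absv (\<beta> j - qconj (\<beta> j)) * a) \<le>
              (absv (y - \<beta> j) * a) * (absv (qconj y - qconj (\<beta> j)) * a) * absv (\<omega> - \<omega>') ^ 2"
            by (simp only: mult_ac)
          also have "\<dots> \<le> max (V * a) vj * max (U * a) B * (D ^ s) ^ 2"
          proof (intro mult_mono power_mono yb yb' om(3))
            show "0 \<le> max (V * a) vj" using vjq by simp
            thus "0 \<le> max (V * a) vj * max (U * a) B" using B by simp
          qed (use a in auto)
          finally show "(U * a) * B \<le> max (V * a) vj * max (U * a) B * (D ^ s) ^ 2" by (simp add: U_j)
          show "0 < vj" "1 \<le> B" "1 < D" "1 \<le> D ^ s" "V * a < U * a" "vj < B" using vjq B D E \<open>V * a < U * a\<close> \<open>vj < B\<close> by auto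
          show "0 < U * a" "0 \<le> V * a" using U a by (auto simp: V_def)
          show "U * a \<le> D" using j(1) by (simp add: a_def)
          have "vj * 1 \<le> vj * (V * a * D ^ 2 * ?q ^ m')" using v vjq by (intro mult_left_mono) auto
          also have "\<dots> = (V * a * D ^ 2) * (vj * ?q ^ m')" by (simp add: mult.commute mult.left_commute)
          finally show "vj \<le> V * a * D ^ 2" by (simp add: vjq)
          have "D ^ 2 * (D ^ s) ^ 2 * vj \<le> B * ?q ^ m' * vj" using M vjq unfolding qm by (intro mult_right_mono) auto
          also have "\<dots> = B * (vj * ?q ^ m')" by simp
          finally show "D ^ 2 * (D ^ s) ^ 2 * vj \<le> B" by (simp add: vjq)
        qed
      qed
      hence "(U * vj) * a \<le> (V * B) * a" by (simp only: mult_ac)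
      hence "U * vj \<le> V * B" using a by simp
      hence "U * vj * ?q ^ m' \<le> V * B * ?q ^ m'" using q by (intro mult_right_mono) auto
      thus ?thesis using vjq by (simp add: qm mult.assoc)
    qed
    thus ?thesis using U q by (simp add: U_def V_def field_simps)
  qed

  let ?F = "inf (principal ?T) (filtercomap (\<lambda>\<beta>. absv (\<beta> - qconj \<beta>)) (nhds 0))"
  let ?g = "\<lambda>\<beta>. ereal (absv (f - \<beta>) / absv (\<beta> - qconj \<beta>))"
  have ev: "eventually P ?F \<longleftrightarrow>
      (\<exists>S. eventually S (nhds (0::real)) \<and> (\<forall>y. S (absv (y - qconj y)) \<longrightarrow> y \<in> ?T \<longrightarrow> P y))" for P
    by (subst inf_commute) (simp add: eventually_inf_principal eventually_filtercomap)
  have "ereal (inverse (?q ^ m)) \<le> Liminf ?F ?g"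
  proof (rule Liminf_bounded)
    \<comment> \<open>Below this threshold copy 0 meets the bound, which is what
      \<open>lower\<close> needs to find j.\<close>
    have "eventually (\<lambda>t::real. t < D / absv A ^ 2) (nhds 0)"
      using D A0 by (intro eventually_nhds_in_open[of "{..<D / absv A ^ 2}", simplified]) auto
    moreover have "y \<in> ?T \<longrightarrow> ereal (inverse (?q ^ m)) \<le> ?g y" if "absv (y - qconj y) < D / absv A ^ 2" for y
    proof -
      have "absv (y - qconj y) * absv A ^ 2 \<le> D" using that A0 by (simp add: less_divide_eq)
      thus ?thesis using lower by simp
    qed
    ultimately show "eventually (\<lambda>y. ereal (inverse (?q ^ m)) \<le> ?g y) ?F" unfolding ev by blast
  qed
  moreover have "Liminf ?F ?g \<le> ereal (inverse (?q ^ m))"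
  proof (rule ccontr)
    assume "\<not> ?thesis"
    hence "ereal (inverse (?q ^ m)) < Liminf ?F ?g" by (simp only: not_le)
    hence "eventually (\<lambda>y. ereal (inverse (?q ^ m)) < ?g y) ?F" by (rule less_LiminfD)
    then obtain S where S: "eventually S (nhds (0::real))"
      "\<And>y. S (absv (y - qconj y)) \<Longrightarrow> y \<in> ?T \<Longrightarrow> ereal (inverse (?q ^ m)) < ?g y"
      unfolding ev by blast
    from S(1) obtain \<epsilon> where \<epsilon>: "0 < \<epsilon>" "\<And>t. \<bar>t\<bar> < \<epsilon> \<Longrightarrow> S t"
      unfolding eventually_nhds_metric by (auto simp: dist_real_def)
    \<comment> \<open>The points \<open>\<beta> j\<close> have conjugate distance tending to 0, so
      they enter every neighbourhood, and their ratio is exactly q^-m.\<close>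
    obtain j where j: "D < \<epsilon> * (Q ^ j * absv A) ^ 2" using grow[OF \<epsilon>(1)] by blast
    have "absv (\<beta> j - qconj (\<beta> j)) < \<epsilon>"
    proof (rule ccontr)
      assume "\<not> ?thesis"
      hence "\<epsilon> * (Q ^ j * absv A) ^ 2 \<le> absv (\<beta> j - qconj (\<beta> j)) * (Q ^ j * absv A) ^ 2"
        by (intro mult_right_mono) auto
      thus False using j Uj[of j] B(2) by linarith
    qed
    hence "ereal (inverse (?q ^ m)) < ?g (\<beta> j)" by (intro S(2) \<epsilon>(2) \<beta>T) simp
    thus False by (simp add: ratio)
  qed
  ultimately have "capprox (x 0) f = ereal (inverse (?q ^ m))" unfolding capprox_def by (rule antisym[rotated])
  thus ?thesis using fK fT by blast
qed

end

section \<open>Passage to the periodic part and conclusion\<close>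

lemma biperiodic_exists:
  fixes \<alpha> :: "'a::{finite,field} fls"
  assumes conj: "conjp \<alpha> \<alpha>'"
  shows "\<exists>b x x'. biperiodic b x x' (cf_period \<alpha>) (real CARD('a) ^ cf_maxdeg \<alpha>) \<and> x 0 \<in> Theta \<alpha>"
proof -
  let ?s = "cf_period \<alpha>"
  note per = cf_period_facts[OF conj]
  obtain N0 where N0: "0 < N0" "\<And>n. N0 \<le> n \<Longrightarrow> absv (qconj (cf_rem \<alpha> n)) < 1"
    using eventually_reduced[OF conj] by blast
  define N where "N = max N0 (cf_preperiod \<alpha>)"
  \<comment> \<open>Wraps an integer index into one period, starting at N, from where the quotients
    are both periodic and reduced.\<close>
  define ix where "ix n = N + nat (n mod int ?s)" for n
  have ixN: "N \<le> ix n" for n by (simp add: ix_def)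
  have ix0: "N0 \<le> ix n" "cf_preperiod \<alpha> \<le> ix n" "0 < ix n" for n
    using ixN[of n] N0(1) by (auto simp: N_def)
  have step: "cf_rem \<alpha> (ix (n + 1)) = cf_rem \<alpha> (Suc (ix n))" for n
  proof -
    define k where "k = n mod int ?s"
    have k: "0 \<le> k" "k < int ?s" using per(1) by (simp_all add: k_def)
    have m: "(n + 1) mod int ?s = (k + 1) mod int ?s" by (simp add: k_def mod_add_left_eq)
    show ?thesis
    proof (cases "k + 1 = int ?s")
      case True
      \<comment> \<open>At the end of the block the index jumps back to N, which periodicity of the
        complete quotients absorbs.\<close>
      hence "ix (n + 1) = N" "Suc (ix n) = N + ?s" using k by (auto simp: ix_def m k_def[symmetric])
      thus ?thesis using per(2)[of N] by (simp add: N_def)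
    next
      case False
      hence "(k + 1) mod int ?s = k + 1" using k by (intro mod_pos_pos_trivial) auto
      thus ?thesis using k by (simp add: ix_def m k_def[symmetric] nat_add_distrib)
    qed
  qed
  define b x x' where "b n = cf_quot \<alpha> (ix n)" and "x n = inverse (cf_rem \<alpha> (ix n))"
    and "x' n = inverse (qconj (cf_rem \<alpha> (ix n)))" for n
  have "biperiodic b x x' ?s (real CARD('a) ^ cf_maxdeg \<alpha>)"
  proof
    fix n
    note nz = cf_rem_nonzero[OF conj, of "ix n"]
    show "b n \<in> Rpoly" by (simp add: b_def cf_quot_def)
    show "x n * (b n + x (n + 1)) = 1"
      using nz by (simp add: x_def b_def step flip: cf_rem_minus_quot[OF conj])
    show "x' n * (b n + x' (n + 1)) = 1"
      using nz by (simp add: x'_def b_def step flip: qconj_cf_rem_minus_quot[OF conj])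
    show "absv (x n) < 1"
      using absv_cf_rem[OF conj ix0(3)] by (simp add: x_def absv_inverse inverse_less_1_iff)
    show "1 < absv (x' n)"
      using N0(2)[OF ix0(1)] nz(2) by (simp add: x'_def absv_inverse one_less_inverse_iff)
    show "absv (b n) \<le> real CARD('a) ^ cf_maxdeg \<alpha>"
      using per(3)[OF ix0(2)] card_gt_one[where 'a='a] by (simp add: b_def powr_realpow)
    show "x (n + int ?s) = x n" "x' (n + int ?s) = x' n" by (simp_all add: x_def x'_def ix_def)
    show "0 < ?s" by (rule per(1))
    have "gl2 0 1 1 (0 :: 'a fls)" using gl2_cf_step[of "0 :: 'a fls"] by simp
    from conjp_mob[OF this cf_rem_conjp[OF conj, of "ix n"]] show "conjp (x n) (x' n)"
      by (simp add: x_def x'_def mob_def inverse_eq_divide)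
  qed
  moreover have "x 0 \<in> Theta \<alpha>"
    using Theta_cf_step(1)[OF conj cf_rem_Theta[OF conj, of "ix 0"], of 0] by (simp add: x_def)
  ultimately show ?thesis by blast
qed

theorem theorem4p3:
  fixes \<alpha> :: "'a::{finite,field} fls"
  assumes "\<alpha> \<in> K2"
  shows "(\<exists>m\<^sub>\<alpha>::int. \<forall>m::int. m \<ge> m\<^sub>\<alpha> \<longrightarrow>
            ereal (real CARD('a) powr (- real_of_int m)) \<in> Sp \<alpha>)
       \<and> (\<forall>m::int. m \<ge> 2 * int (cf_maxdeg \<alpha>) * (int (cf_period \<alpha>) + 1) \<longrightarrow>
            ereal (real CARD('a) powr (- real_of_int m)) \<in> Sp \<alpha>)"
proof -
  let ?q = "real CARD('a)" and ?d = "cf_maxdeg \<alpha>" and ?s = "cf_period \<alpha>"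
  note conj = K2_conjp[OF assms]
  obtain b x x' where bp: "biperiodic b x x' ?s (?q ^ ?d)" and x0: "x 0 \<in> Theta \<alpha>"
    using biperiodic_exists[OF conj] by blast
  have Th: "Theta (x 0) = Theta \<alpha>" by (rule Theta_cong[OF conj x0])
  have "ereal (?q powr (- real_of_int m)) \<in> Sp \<alpha>" if m: "m \<ge> 2 * int ?d * (int ?s + 1)" for m
  proof -
    have "0 \<le> 2 * int ?d * (int ?s + 1)" by simp
    with m have m0: "0 \<le> m" by linarith
    have "int (2 * ?d + 2 * ?d * ?s) \<le> m" using m by (simp add: algebra_simps)
    hence "2 * ?d + 2 * ?d * ?s \<le> nat m" by linarith
    hence "?q ^ (2 * ?d + 2 * ?d * ?s) \<le> ?q ^ nat m"
      using card_gt_one[where 'a='a] by (intro power_increasing) auto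
    \<comment> \<open>With D = q^d the hypothesis of \<open>realise_value\<close> reads 2d + 2ds
      \<le> m, which is the source of 2d(s + 1).\<close>
    hence "(?q ^ ?d) ^ 2 * ((?q ^ ?d) ^ ?s) ^ 2 \<le> ?q ^ nat m"
      by (simp add: power_add power_mult[symmetric] ac_simps)
    from biperiodic.realise_value[OF bp this] obtain f where f: "f \<notin> Kfrac" "f \<notin> Theta \<alpha>"
      "capprox (x 0) f = ereal (inverse (?q ^ nat m))"
      unfolding Th by blast
    \<comment> \<open>\<open>capprox\<close> depends on its first argument only through the orbit,
      so x 0 may be traded for \<alpha>.\<close>
    have "capprox \<alpha> f = ereal (?q powr (- real_of_int m))"
      using f(3) m0 card_gt_one[where 'a='a]
      by (simp add: capprox_def Th powr_minus powr_realpow[symmetric])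
    with f(1,2) show ?thesis unfolding Sp_def by (metis (mono_tags, lifting) mem_Collect_eq)
  qed
  thus ?thesis by blast
qed

end
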